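(* Let $N\ge2$ and let $s_i\mapsto S_i$ be a representation of $\mathcal{O}_N$ on a Hilbert space $\mathcal{K}$ such that $S_0$ is a shift. Then there exists a unitary operator $$V:\mathcal{H}_+\Bigl(\bigoplus_{j=1}^{N-1}\mathcal{K}\Bigr)\longrightarrow\mathcal{K}$$ such that, if $S_j^+=V^*S_jV$, then $$S_0^+=M_z=\text{multiplication by }z$$ and $$S_j^+\psi=z\Bigl(\bigl(\textstyle\bigoplus_{i=1}^{j-1}0\bigr)\oplus V\psi\oplus\bigl(\bigoplus_{i=j+1}^{N-1}0\bigr)\Bigr)$$ for $j=1,\dots,N-1$ and all $\psi\in\mathcal{H}_+\bigl(\bigoplus_{j=1}^{N-1}\mathcal{K}\bigr)$.
   Context: A representation of the Cuntz algebra $\mathcal{O}_N$ on $\mathcal{K}$ is a family of operators $S_0,\dots,S_{N-1}$ with $S_i^*S_j=\delta_{ij}1$ and $\sum_iS_iS_i^*=1$. An isometry $S$ on $\mathcal{K}$ is called a shift if $\bigcap_{n\ge1}S^n\mathcal{K}=\{0\}$. For a Hilbert space $\mathcal{L}$, $\mathcal{H}_+(\mathcal{L})=H_+^2(\mathbb{T})\otimes\mathcal{L}$, where $H^2_+(\mathbb{T})\subset L^2(\mathbb{T})$ is the closed linear span of the functions $z\mapsto z^n$, $n=1,2,3,\dots$; its elements are the functions $\xi(z)=\sum_{n=1}^\infty\xi_nz^n$ with $\xi_n\in\mathcal{L}$ and $\|\xi\|^2=\sum_{n\ge1}\|\xi_n\|^2<\infty$. In the formula for $S_j^+\psi$, the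 expression in parentheses is a (constant) element of $\bigoplus_{i=1}^{N-1}\mathcal{K}$ with $V\psi$ in the $j$'th slot. *)

theory Defs
  imports "HOL-Analysis.Analysis"
begin

section \<open>Complex Hilbert spaces\<close>

text \<open>The complex inner product is conjugate linear in the first argument; its real part is
  the inner product of the underlying class \<open>real_inner\<close>, so norm and topology are inherited.\<close>

class complex_inner = real_inner +
  fixes scaleC :: "complex \<Rightarrow> 'a \<Rightarrow> 'a" (infixr \<open>*\<^sub>C\<close> 75)
    and cinner :: "'a \<Rightarrow> 'a \<Rightarrow> complex"
  assumes scaleC_add_right: "c *\<^sub>C (x + y) = c *\<^sub>C x + c *\<^sub>C y"
    and scaleC_add_left: "(c + d) *\<^sub>C x = c *\<^sub>C x + d *\<^sub>C x"
    and scaleC_scaleC: "c *\<^sub>C d *\<^sub>C x = (c * d) *\<^sub>C x"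
    and scaleC_one: "1 *\<^sub>C x = x"
    and scaleR_scaleC: "scaleR r x = complex_of_real r *\<^sub>C x"
    and cinner_commute: "cinner x y = cnj (cinner y x)"
    and cinner_add_right: "cinner x (y + z) = cinner x y + cinner x z"
    and cinner_scaleC_right: "cinner x (c *\<^sub>C y) = c * cinner x y"
    and inner_eq_Re_cinner: "inner x y = Re (cinner x y)"

class chilbert_space = complex_inner + complete_space

interpretation complex_vector: vector_space "scaleC :: complex \<Rightarrow> 'a \<Rightarrow> 'a::complex_inner"
  by unfold_locales
    (simp_all add: scaleC_add_right scaleC_add_left scaleC_scaleC scaleC_one)

lemma cinner_add_left: "cinner (x + y) z = cinner x z + cinner y z"
  by (metis cinner_add_right cinner_commute complex_cnj_add)

lemma cinner_scaleC_left: "cinner (c *\<^sub>C x) y = cnj c * cinner x y"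
  by (metis cinner_commute cinner_scaleC_right complex_cnj_mult)

lemma cinner_self: "cinner x x = complex_of_real ((norm x)\<^sup>2)"
proof -
  have "Im (cinner x x) = 0"
    using cinner_commute[of x x] by (metis cnj.simps(2) neg_equal_zero)
  moreover have "Re (cinner x x) = (norm x)\<^sup>2"
    by (simp flip: inner_eq_Re_cinner add: power2_norm_eq_inner)
  ultimately show ?thesis by (simp add: complex_eq_iff)
qed

lemma norm_scaleC: "norm (c *\<^sub>C x) = cmod c * norm x"
proof -
  have "complex_of_real ((norm (c *\<^sub>C x))\<^sup>2) = c * cnj c * cinner x x"
    unfolding cinner_self[symmetric] by (simp add: cinner_scaleC_left cinner_scaleC_right)
  also have "\<dots> = complex_of_real ((cmod c * norm x)\<^sup>2)"
    by (simp add: cinner_self power_mult_distrib flip: complex_norm_square)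
  finally have "(norm (c *\<^sub>C x))\<^sup>2 = (cmod c * norm x)\<^sup>2"
    by (simp only: of_real_eq_iff)
  then show ?thesis
    by (simp add: power2_eq_iff_nonneg)
qed

lemma norm_cinner_le: "cmod (cinner x y) \<le> norm x * norm y"
proof (cases "cinner x y = 0")
  case False
  define c where "c = cnj (cinner x y) / cmod (cinner x y)"
  have c: "cmod c = 1" using False by (simp add: c_def norm_divide)
  have "cinner x (c *\<^sub>C y) = complex_of_real (cmod (cinner x y))"
    using False
    by (simp add: c_def cinner_scaleC_right field_simps complex_norm_square[symmetric]
        power2_eq_square)
  then have "cmod (cinner x y) = inner x (c *\<^sub>C y)"
    by (simp add: inner_eq_Re_cinner)
  also have "\<dots> \<le> norm x * norm (c *\<^sub>C y)" by (rule norm_cauchy_schwarz)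
  finally show ?thesis by (simp add: norm_scaleC c)
qed simp

lemma bounded_bilinear_cinner: "bounded_bilinear (cinner :: 'a::complex_inner \<Rightarrow> 'a \<Rightarrow> complex)"
proof
  show "cinner (r *\<^sub>R x) y = r *\<^sub>R cinner x y" for r and x y :: 'a
    by (simp add: scaleR_scaleC cinner_scaleC_left scaleR_conv_of_real)
  show "cinner x (r *\<^sub>R y) = r *\<^sub>R cinner x y" for r and x y :: 'a
    by (simp add: scaleR_scaleC cinner_scaleC_right scaleR_conv_of_real)
  show "\<exists>K. \<forall>x y :: 'a. cmod (cinner x y) \<le> norm x * norm y * K"
    by (rule exI[of _ 1]) (simp add: norm_cinner_le)
qed (simp_all add: cinner_add_left cinner_add_right)

lemma bounded_bilinear_scaleC:
  "bounded_bilinear (scaleC :: complex \<Rightarrow> 'a \<Rightarrow> 'a::complex_inner)"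
proof
  show "(r *\<^sub>R c) *\<^sub>C x = r *\<^sub>R c *\<^sub>C x" for r c and x :: 'a
    by (simp add: scaleR_scaleC scaleC_scaleC scaleR_conv_of_real)
  show "c *\<^sub>C r *\<^sub>R x = r *\<^sub>R c *\<^sub>C x" for r c and x :: 'a
    by (simp add: scaleR_scaleC scaleC_scaleC mult.commute)
  show "\<exists>K. \<forall>c. \<forall>x :: 'a. norm (c *\<^sub>C x) \<le> norm c * norm x * K"
    by (rule exI[of _ 1]) (simp add: norm_scaleC)
qed (simp_all add: scaleC_add_left scaleC_add_right)

text \<open>\<open>'a ^ 'n\<close> is the Hilbert space direct sum of copies of \<open>'a\<close> indexed by \<open>'n\<close>.\<close>

instantiation vec :: (complex_inner, finite) complex_inner
begin

definition scaleC_vec :: "complex \<Rightarrow> 'a ^ 'b \<Rightarrow> 'a ^ 'b"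
  where "c *\<^sub>C x = (\<chi> i. c *\<^sub>C (x $ i))"

definition cinner_vec :: "'a ^ 'b \<Rightarrow> 'a ^ 'b \<Rightarrow> complex"
  where "cinner x y = (\<Sum>i\<in>UNIV. cinner (x $ i) (y $ i))"

instance
proof
  fix x y z :: "'a ^ 'b" and c d :: complex and r :: real
  show "c *\<^sub>C (x + y) = c *\<^sub>C x + c *\<^sub>C y"
    by (simp add: scaleC_vec_def vec_eq_iff scaleC_add_right)
  show "(c + d) *\<^sub>C x = c *\<^sub>C x + d *\<^sub>C x"
    by (simp add: scaleC_vec_def vec_eq_iff scaleC_add_left)
  show "c *\<^sub>C d *\<^sub>C x = (c * d) *\<^sub>C x"
    by (simp add: scaleC_vec_def vec_eq_iff scaleC_scaleC)
  show "1 *\<^sub>C x = x"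
    by (simp add: scaleC_vec_def vec_eq_iff scaleC_one)
  show "r *\<^sub>R x = complex_of_real r *\<^sub>C x"
    by (simp add: scaleC_vec_def vec_eq_iff scaleR_scaleC)
  show "cinner x y = cnj (cinner y x)"
    unfolding cinner_vec_def cnj_sum by (rule sum.cong[OF refl]) (rule cinner_commute)
  show "cinner x (y + z) = cinner x y + cinner x z"
    by (simp add: cinner_vec_def cinner_add_right sum.distrib)
  show "cinner x (c *\<^sub>C y) = c * cinner x y"
    by (simp add: cinner_vec_def scaleC_vec_def cinner_scaleC_right sum_distrib_left)
  show "inner x y = Re (cinner x y)"
    by (simp add: cinner_vec_def inner_vec_def inner_eq_Re_cinner)
qed

end

instance vec :: (chilbert_space, finite) chilbert_space ..

section \<open>Operators\<close>

definition bounded_clinear :: "('a::complex_inner \<Rightarrow> 'b::complex_inner) \<Rightarrow> bool" where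
  "bounded_clinear T \<longleftrightarrow> bounded_linear T \<and> (\<forall>c x. T (c *\<^sub>C x) = c *\<^sub>C T x)"

text \<open>The adjoint of an operator \<open>T\<close> from a closed subspace \<open>H\<close> of \<open>'a\<close>, regarded as a Hilbert
  space of its own, to \<open>'b\<close>; it takes values in \<open>H\<close>. For bounded \<open>T\<close> and complete \<open>H\<close> the
  described vector exists by the Riesz representation theorem.\<close>

definition cadjoint_on ::
  "'a set \<Rightarrow> ('a::complex_inner \<Rightarrow> 'b::complex_inner) \<Rightarrow> 'b \<Rightarrow> 'a" where
  "cadjoint_on H T y = (THE x. x \<in> H \<and> (\<forall>g\<in>H. cinner x g = cinner y (T g)))"

abbreviation cadjoint :: "('a::complex_inner \<Rightarrow> 'b::complex_inner) \<Rightarrow> 'b \<Rightarrow> 'a" where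
  "cadjoint \<equiv> cadjoint_on UNIV"

definition unitary_on :: "'a set \<Rightarrow> ('a::complex_inner \<Rightarrow> 'b::complex_inner) \<Rightarrow> bool" where
  "unitary_on H V \<longleftrightarrow>
    (\<forall>f\<in>H. \<forall>g\<in>H. V (f + g) = V f + V g) \<and>
    (\<forall>c. \<forall>f\<in>H. V (c *\<^sub>C f) = c *\<^sub>C V f) \<and>
    (\<forall>f\<in>H. \<forall>g\<in>H. cinner (V f) (V g) = cinner f g) \<and>
    V ` H = UNIV"

definition cuntz_representation ::
  "nat \<Rightarrow> (nat \<Rightarrow> 'k::chilbert_space \<Rightarrow> 'k) \<Rightarrow> bool" where
  "cuntz_representation N S \<longleftrightarrow>
    (\<forall>i<N. bounded_clinear (S i)) \<and>
    (\<forall>i<N. \<forall>j<N. \<forall>x. cadjoint (S i) (S j x) = (if i = j then x else 0)) \<and>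
    (\<forall>x. (\<Sum>i<N. S i (cadjoint (S i) x)) = x)"

definition is_shift :: "('k::chilbert_space \<Rightarrow> 'k) \<Rightarrow> bool" where
  "is_shift S \<longleftrightarrow>
    bounded_clinear S \<and> (\<forall>x. norm (S x) = norm x) \<and> (\<Inter>n\<in>{1..}. range (S ^^ n)) = {0}"

section \<open>Square integrable functions on the circle\<close>

text \<open>Normalised arc length, as a measure on the plane that is concentrated on the unit circle.\<close>

definition circle_measure :: "complex measure" where
  "circle_measure = distr (restrict_space lborel {0..1}) borel (\<lambda>t. cis (2 * pi * t))"

lemma space_circle_measure [simp]: "space circle_measure = UNIV"
  by (simp add: circle_measure_def)

lemma sets_circle_measure [simp, measurable_cong]: "sets circle_measure = sets borel"
  by (simp add: circle_measure_def)

lemma measurable_circle_param: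
  "(\<lambda>t. cis (2 * pi * t)) \<in> borel_measurable (restrict_space lborel {0..1})"
  by (rule measurable_restrict_space1)
    (auto intro!: borel_measurable_continuous_onI continuous_intros)

lemma finite_measure_circle: "finite_measure circle_measure"
  unfolding circle_measure_def
  by (rule finite_measure.finite_measure_distr[OF _ measurable_circle_param])
    (rule finite_measureI, simp add: emeasure_restrict_space)

lemma AE_circle_norm: "AE z in circle_measure. cmod z = 1"
  unfolding circle_measure_def
  by (subst AE_distr_iff[OF measurable_circle_param]) auto

text \<open>The target space need not be separable, so measurability of vector valued functions means
  being a pointwise limit of simple functions.\<close>

definition strongly_measurable :: "'a measure \<Rightarrow> ('a \<Rightarrow> 'b::topological_space) \<Rightarrow> bool" where
  "strongly_measurable M f \<longleftrightarrow>
    (\<exists>s. (\<forall>n. simple_function M (s n)) \<and> (\<forall>x\<in>space M. (\<lambda>n. s n x) \<longlonglongrightarrow> f x))"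

lemma strongly_measurable_const: "strongly_measurable M (\<lambda>_. c)"
  unfolding strongly_measurable_def by (rule exI[of _ "\<lambda>_ _. c"]) auto

lemma strongly_measurable_borel:
  fixes f :: "'a \<Rightarrow> 'b::metric_space"
  assumes "strongly_measurable M f"
  shows "f \<in> borel_measurable M"
  using assms unfolding strongly_measurable_def
  by (metis borel_measurable_LIMSEQ_metric borel_measurable_simple_function)

lemma borel_strongly_measurable:
  fixes f :: "'a \<Rightarrow> 'b::{metric_space, second_countable_topology}"
  assumes "f \<in> borel_measurable M"
  shows "strongly_measurable M f"
  using borel_measurable_implies_sequence_metric[OF assms, of undefined]
  unfolding strongly_measurable_def by blast

lemma strongly_measurable_compose2:
  assumes "strongly_measurable M f" "strongly_measurable M g"
    and h: "\<And>X Y x y. X \<longlonglongrightarrow> x \<Longrightarrow> Y \<longlonglongrightarrow> y \<Longrightarrow> (\<lambda>n. h (X n) (Y n)) \<longlonglongrightarrow> h x y"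
  shows "strongly_measurable M (\<lambda>x. h (f x) (g x))"
proof -
  from assms obtain s t where
    "\<And>n. simple_function M (s n)" "\<And>x. x \<in> space M \<Longrightarrow> (\<lambda>n. s n x) \<longlonglongrightarrow> f x"
    "\<And>n. simple_function M (t n)" "\<And>x. x \<in> space M \<Longrightarrow> (\<lambda>n. t n x) \<longlonglongrightarrow> g x"
    unfolding strongly_measurable_def by metis
  then show ?thesis
    unfolding strongly_measurable_def
    by (intro exI[of _ "\<lambda>n x. h (s n x) (t n x)"])
      (auto intro: h simple_function_compose2[of _ _ _ h])
qed

lemma strongly_measurable_add:
  fixes f g :: "'a \<Rightarrow> 'b::real_normed_vector"
  shows "strongly_measurable M f \<Longrightarrow> strongly_measurable M g \<Longrightarrow>
    strongly_measurable M (\<lambda>x. f x + g x)"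
  by (rule strongly_measurable_compose2[of _ _ _ "(+)"]) (auto intro: tendsto_add)

lemma strongly_measurable_scaleC:
  fixes f :: "'a \<Rightarrow> 'b::complex_inner"
  shows "strongly_measurable M a \<Longrightarrow> strongly_measurable M f \<Longrightarrow>
    strongly_measurable M (\<lambda>x. a x *\<^sub>C f x)"
  by (rule strongly_measurable_compose2[of _ _ _ scaleC])
    (auto intro: bounded_bilinear.tendsto[OF bounded_bilinear_scaleC])

lemma strongly_measurable_cinner:
  fixes f g :: "'a \<Rightarrow> 'b::complex_inner"
  shows "strongly_measurable M f \<Longrightarrow> strongly_measurable M g \<Longrightarrow>
    strongly_measurable M (\<lambda>x. cinner (f x) (g x))"
  by (rule strongly_measurable_compose2[of _ _ _ cinner])
    (auto intro: bounded_bilinear.tendsto[OF bounded_bilinear_cinner])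

definition square_integrable :: "(complex \<Rightarrow> 'a::complex_inner) \<Rightarrow> bool" where
  "square_integrable f \<longleftrightarrow>
    strongly_measurable circle_measure f \<and> integrable circle_measure (\<lambda>z. (norm (f z))\<^sup>2)"

lemma square_integrable_add:
  assumes "square_integrable f" "square_integrable g"
  shows "square_integrable (\<lambda>z. f z + g z)"
proof -
  have sm: "strongly_measurable circle_measure (\<lambda>z. f z + g z)"
    using assms by (auto simp: square_integrable_def intro: strongly_measurable_add)
  have "integrable circle_measure (\<lambda>z. 2 * (norm (f z))\<^sup>2 + 2 * (norm (g z))\<^sup>2)"
    using assms by (auto simp: square_integrable_def)
  then have "integrable circle_measure (\<lambda>z. (norm (f z + g z))\<^sup>2)"
  proof (rule Bochner_Integration.integrable_bound)
    show "(\<lambda>z. (norm (f z + g z))\<^sup>2) \<in> borel_measurable circle_measure"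
      using strongly_measurable_borel[OF sm] by measurable
    have "(norm (f z + g z))\<^sup>2 \<le> 2 * (norm (f z))\<^sup>2 + 2 * (norm (g z))\<^sup>2" for z
    proof -
      have "(norm (f z + g z))\<^sup>2 \<le> (norm (f z) + norm (g z))\<^sup>2"
        by (intro power_mono norm_triangle_ineq norm_ge_zero)
      also have "\<dots> \<le> 2 * (norm (f z))\<^sup>2 + 2 * (norm (g z))\<^sup>2"
        using sum_squares_bound[of "norm (f z)" "norm (g z)"] by (simp add: power2_sum)
      finally show ?thesis .
    qed
    then show "AE z in circle_measure. norm ((norm (f z + g z))\<^sup>2)
        \<le> norm (2 * (norm (f z))\<^sup>2 + 2 * (norm (g z))\<^sup>2)"
      by (intro AE_I2) (metis abs_ge_self order_trans power2_norm_eq_inner real_norm_def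
          abs_of_nonneg zero_le_power2)
  qed
  with sm show ?thesis by (simp add: square_integrable_def)
qed

lemma square_integrable_scaleC_fun:
  assumes f: "square_integrable f" and a: "a \<in> borel_measurable borel"
    and bound: "AE z in circle_measure. cmod (a z) = B"
  shows "square_integrable (\<lambda>z. a z *\<^sub>C f z)"
proof -
  have sm: "strongly_measurable circle_measure (\<lambda>z. a z *\<^sub>C f z)"
    using f a by (auto simp: square_integrable_def
        intro!: strongly_measurable_scaleC borel_strongly_measurable)
  have "integrable circle_measure (\<lambda>z. B\<^sup>2 * (norm (f z))\<^sup>2)"
    using f by (simp add: square_integrable_def)
  then have "integrable circle_measure (\<lambda>z. (norm (a z *\<^sub>C f z))\<^sup>2)"
  proof (rule Bochner_Integration.integrable_bound)
    show "(\<lambda>z. (norm (a z *\<^sub>C f z))\<^sup>2) \<in> borel_measurable circle_measure"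
      using strongly_measurable_borel[OF sm] by measurable
    show "AE z in circle_measure. norm ((norm (a z *\<^sub>C f z))\<^sup>2) \<le> norm (B\<^sup>2 * (norm (f z))\<^sup>2)"
      using bound by eventually_elim (simp add: norm_scaleC power_mult_distrib)
  qed
  with sm show ?thesis by (simp add: square_integrable_def)
qed

lemma square_integrable_scaleC: "square_integrable f \<Longrightarrow> square_integrable (\<lambda>z. c *\<^sub>C f z)"
  by (rule square_integrable_scaleC_fun[where B = "cmod c"]) auto

lemma square_integrable_const: "square_integrable (\<lambda>_. x)"
  by (simp add: square_integrable_def strongly_measurable_const
      finite_measure.integrable_const[OF finite_measure_circle])

lemma square_integrable_cinner:
  assumes "square_integrable f" "square_integrable g"
  shows "integrable circle_measure (\<lambda>z. cinner (f z) (g z))"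
proof -
  have "integrable circle_measure (\<lambda>z. (norm (f z))\<^sup>2 + (norm (g z))\<^sup>2)"
    using assms by (auto simp: square_integrable_def)
  then show ?thesis
  proof (rule Bochner_Integration.integrable_bound)
    show "(\<lambda>z. cinner (f z) (g z)) \<in> borel_measurable circle_measure"
      using assms by (auto simp: square_integrable_def
          intro!: strongly_measurable_borel strongly_measurable_cinner)
    have "cmod (cinner x y) \<le> (norm x)\<^sup>2 + (norm y)\<^sup>2" for x y :: 'a
      using norm_cinner_le[of x y] sum_squares_bound[of "norm x" "norm y"]
        mult_nonneg_nonneg[OF norm_ge_zero[of x] norm_ge_zero[of y]] by linarith
    then show "AE z in circle_measure. norm (cinner (f z) (g z))
        \<le> norm ((norm (f z))\<^sup>2 + (norm (g z))\<^sup>2)"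
      by (intro AE_I2) (metis abs_of_nonneg add_nonneg_nonneg real_norm_def zero_le_power2)
  qed
qed

definition L2_rel :: "(complex \<Rightarrow> 'a::complex_inner) \<Rightarrow> (complex \<Rightarrow> 'a) \<Rightarrow> bool" where
  "L2_rel f g \<longleftrightarrow>
    square_integrable f \<and> square_integrable g \<and> (AE z in circle_measure. f z = g z)"

quotient_type (overloaded) 'a L2_circle = "complex \<Rightarrow> 'a::complex_inner" / partial: L2_rel
proof (rule part_equivpI)
  show "\<exists>f :: complex \<Rightarrow> 'a. L2_rel f f"
    by (rule exI[of _ "\<lambda>_. 0"]) (simp add: L2_rel_def square_integrable_const)
  show "symp (L2_rel :: (complex \<Rightarrow> 'a) \<Rightarrow> _)"
    by (auto intro!: sympI simp: L2_rel_def elim: eventually_mono)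
  show "transp (L2_rel :: (complex \<Rightarrow> 'a) \<Rightarrow> _)"
    by (rule transpI) (auto simp: L2_rel_def elim: eventually_elim2)
qed

instantiation L2_circle :: (complex_inner) complex_inner
begin

lift_definition zero_L2_circle :: "'a L2_circle" is "\<lambda>_. 0"
  by (simp add: L2_rel_def square_integrable_const)

lift_definition plus_L2_circle :: "'a L2_circle \<Rightarrow> 'a L2_circle \<Rightarrow> 'a L2_circle"
  is "\<lambda>f g z. f z + g z"
  by (auto simp: L2_rel_def square_integrable_add elim: eventually_elim2)

lift_definition scaleC_L2_circle :: "complex \<Rightarrow> 'a L2_circle \<Rightarrow> 'a L2_circle"
  is "\<lambda>c f z. c *\<^sub>C f z"
  by (auto simp: L2_rel_def square_integrable_scaleC elim: eventually_mono)

lift_definition cinner_L2_circle :: "'a L2_circle \<Rightarrow> 'a L2_circle \<Rightarrow> complex"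
  is "\<lambda>f g. \<integral>z. cinner (f z) (g z) \<partial>circle_measure"
proof -
  fix f f' g g' :: "complex \<Rightarrow> 'a"
  assume *: "L2_rel f f'" "L2_rel g g'"
  show "(\<integral>z. cinner (f z) (g z) \<partial>circle_measure) = (\<integral>z. cinner (f' z) (g' z) \<partial>circle_measure)"
  proof (rule integral_cong_AE)
    have "AE z in circle_measure. f z = f' z" "AE z in circle_measure. g z = g' z"
      using * by (auto simp: L2_rel_def)
    then show "AE z in circle_measure. cinner (f z) (g z) = cinner (f' z) (g' z)"
      by eventually_elim simp
  qed (use * in \<open>auto simp: L2_rel_def intro!: borel_measurable_integrable square_integrable_cinner\<close>)
qed

definition scaleR_L2_circle :: "real \<Rightarrow> 'a L2_circle \<Rightarrow> 'a L2_circle"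
  where "r *\<^sub>R f = complex_of_real r *\<^sub>C (f :: 'a L2_circle)"

definition uminus_L2_circle :: "'a L2_circle \<Rightarrow> 'a L2_circle"
  where "- f = (- 1) *\<^sub>C (f :: 'a L2_circle)"

definition minus_L2_circle :: "'a L2_circle \<Rightarrow> 'a L2_circle \<Rightarrow> 'a L2_circle"
  where "f - g = f + - (g :: 'a L2_circle)"

definition inner_L2_circle :: "'a L2_circle \<Rightarrow> 'a L2_circle \<Rightarrow> real"
  where "inner f g = Re (cinner f (g :: 'a L2_circle))"

definition norm_L2_circle :: "'a L2_circle \<Rightarrow> real"
  where "norm (f :: 'a L2_circle) = sqrt (inner f f)"

definition sgn_L2_circle :: "'a L2_circle \<Rightarrow> 'a L2_circle"
  where "sgn (f :: 'a L2_circle) = inverse (norm f) *\<^sub>R f"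

definition dist_L2_circle :: "'a L2_circle \<Rightarrow> 'a L2_circle \<Rightarrow> real"
  where "dist f (g :: 'a L2_circle) = norm (f - g)"

definition uniformity_L2_circle :: "('a L2_circle \<times> 'a L2_circle) filter"
  where "uniformity_L2_circle = (INF e\<in>{0<..}. principal {(f, g). dist f (g :: 'a L2_circle) < e})"

definition open_L2_circle :: "'a L2_circle set \<Rightarrow> bool"
  where "open_L2_circle U \<longleftrightarrow> (\<forall>f\<in>U. eventually (\<lambda>(f', g). f' = f \<longrightarrow> g \<in> U) uniformity)"

instance
proof
  fix f g h :: "'a L2_circle" and c d :: complex and r s :: real
  have add_assoc: "f + g + h = f + (g + h)" for f g h :: "'a L2_circle"
    by transfer (auto simp: L2_rel_def add.assoc intro!: square_integrable_add)
  have add_commute: "f + g = g + f" for f g :: "'a L2_circle"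
    by transfer (auto simp: L2_rel_def add.commute intro!: square_integrable_add)
  have zero_add: "0 + f = f" for f :: "'a L2_circle"
    by transfer (auto simp: L2_rel_def)
  have sC_add: "c *\<^sub>C (f + g) = c *\<^sub>C f + c *\<^sub>C g" for c and f g :: "'a L2_circle"
    by transfer (auto simp: L2_rel_def scaleC_add_right
        intro!: square_integrable_add square_integrable_scaleC)
  have sC_add': "(c + d) *\<^sub>C f = c *\<^sub>C f + d *\<^sub>C f" for c d and f :: "'a L2_circle"
    by transfer (auto simp: L2_rel_def scaleC_add_left
        intro!: square_integrable_add square_integrable_scaleC)
  have sC_sC: "c *\<^sub>C d *\<^sub>C f = (c * d) *\<^sub>C f" for c d and f :: "'a L2_circle"
    by transfer (auto simp: L2_rel_def scaleC_scaleC intro!: square_integrable_scaleC)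
  have sC_one: "1 *\<^sub>C f = f" for f :: "'a L2_circle"
    by transfer (auto simp: L2_rel_def scaleC_one)
  have sC_zero: "0 *\<^sub>C f = 0" for f :: "'a L2_circle"
    by transfer (auto simp: L2_rel_def square_integrable_const)
  have minus_self: "- f + f = 0" for f :: "'a L2_circle"
    using sC_add'[of "- 1" 1 f] by (simp add: uminus_L2_circle_def sC_one sC_zero)
  have ci_add: "cinner f (g + h) = cinner f g + cinner f h" for f g h :: "'a L2_circle"
    by transfer (simp add: L2_rel_def cinner_add_right square_integrable_cinner)
  have ci_sC: "cinner f (c *\<^sub>C g) = c * cinner f g" for c and f g :: "'a L2_circle"
    by transfer (simp add: L2_rel_def cinner_scaleC_right)
  have ci_comm: "cinner f g = cnj (cinner g f)" for f g :: "'a L2_circle"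
    by transfer (simp flip: cinner_commute Bochner_Integration.integral_cnj)
  have i_comm: "inner f g = inner g f" for f g :: "'a L2_circle"
    unfolding inner_L2_circle_def by (subst ci_comm) simp
  have ci_self: "\<exists>F. square_integrable F \<and> f = abs_L2_circle F \<and>
      inner f f = (\<integral>z. (norm (F z))\<^sup>2 \<partial>circle_measure)" for f :: "'a L2_circle"
  proof (induction f rule: L2_circle.abs_induct)
    case (1 F)
    then have "cinner (abs_L2_circle F) (abs_L2_circle F) =
        complex_of_real (\<integral>z. (norm (F z))\<^sup>2 \<partial>circle_measure)"
      by (subst cinner_L2_circle.abs_eq) (simp_all add: cinner_self del: of_real_power)
    with 1 show ?case
      by (auto simp: L2_rel_def inner_L2_circle_def intro!: exI[of _ F])
  qed
  show "f + g + h = f + (g + h)" by (rule add_assoc)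
  show "f + g = g + f" by (rule add_commute)
  show "0 + f = f" by (rule zero_add)
  show "- f + f = 0" by (rule minus_self)
  show "f - g = f + - g" by (rule minus_L2_circle_def)
  show "r *\<^sub>R (f + g) = r *\<^sub>R f + r *\<^sub>R g" by (simp add: scaleR_L2_circle_def sC_add)
  show "(r + s) *\<^sub>R f = r *\<^sub>R f + s *\<^sub>R f" by (simp add: scaleR_L2_circle_def sC_add')
  show "r *\<^sub>R s *\<^sub>R f = (r * s) *\<^sub>R f" by (simp add: scaleR_L2_circle_def sC_sC)
  show "1 *\<^sub>R f = f" by (simp add: scaleR_L2_circle_def sC_one)
  show "sgn f = inverse (norm f) *\<^sub>R f" by (rule sgn_L2_circle_def)
  show "dist f g = norm (f - g)" by (rule dist_L2_circle_def)
  show "uniformity = (INF e\<in>{0<..}. principal {(x, y). dist x (y :: 'a L2_circle) < e})"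
    by (rule uniformity_L2_circle_def)
  show "open U = (\<forall>x\<in>U. \<forall>\<^sub>F (x', y) in uniformity. x' = x \<longrightarrow> y \<in> U)" for U :: "'a L2_circle set"
    by (rule open_L2_circle_def)
  show "inner f g = inner g f" by (rule i_comm)
  show "inner (f + g) h = inner f h + inner g h"
    unfolding i_comm[of _ h] by (simp add: inner_L2_circle_def ci_add)
  show "inner (r *\<^sub>R f) g = r * inner f g"
    unfolding i_comm[of _ g] by (simp add: inner_L2_circle_def scaleR_L2_circle_def ci_sC)
  show "0 \<le> inner f f" using ci_self[of f] by auto
  show "inner f f = 0 \<longleftrightarrow> f = 0"
  proof
    assume "inner f f = 0"
    with ci_self[of f] obtain F where F: "square_integrable F" "f = abs_L2_circle F"
      "(\<integral>z. (norm (F z))\<^sup>2 \<partial>circle_measure) = 0" by auto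
    then have "AE z in circle_measure. (norm (F z))\<^sup>2 = 0"
      by (subst integral_nonneg_eq_0_iff_AE[symmetric]) (auto simp: square_integrable_def)
    then have "L2_rel F (\<lambda>_. 0)" using F by (simp add: L2_rel_def square_integrable_const)
    then show "f = 0"
      using F by (metis zero_L2_circle.abs_eq Quotient_rel_abs[OF Quotient_L2_circle])
  next
    assume "f = 0"
    then show "inner f f = 0" unfolding inner_L2_circle_def by simp (transfer, simp add: cinner_self)
  qed
  show "norm f = sqrt (inner f f)" by (rule norm_L2_circle_def)
  show "c *\<^sub>C (f + g) = c *\<^sub>C f + c *\<^sub>C g" by (rule sC_add)
  show "(c + d) *\<^sub>C f = c *\<^sub>C f + d *\<^sub>C f" by (rule sC_add')
  show "c *\<^sub>C d *\<^sub>C f = (c * d) *\<^sub>C f" by (rule sC_sC)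
  show "1 *\<^sub>C f = f" by (rule sC_one)
  show "r *\<^sub>R f = complex_of_real r *\<^sub>C f" by (rule scaleR_L2_circle_def)
  show "cinner f g = cnj (cinner g f)" by (rule ci_comm)
  show "cinner f (g + h) = cinner f g + cinner f h" by (rule ci_add)
  show "cinner f (c *\<^sub>C g) = c * cinner f g" by (rule ci_sC)
  show "inner f g = Re (cinner f g)" by (rule inner_L2_circle_def)
qed

end

section \<open>The space \<open>H\<^sub>+(L)\<close>\<close>

lift_definition constant_L2 :: "'a::complex_inner \<Rightarrow> 'a L2_circle" is "\<lambda>x _. x"
  by (simp add: L2_rel_def square_integrable_const)

lift_definition monomial_L2 :: "nat \<Rightarrow> 'a::complex_inner \<Rightarrow> 'a L2_circle"
  is "\<lambda>n x z. z ^ n *\<^sub>C x"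
proof -
  fix n and x :: 'a
  have "AE z in circle_measure. cmod (z ^ n) = 1"
    using AE_circle_norm by eventually_elim (simp add: norm_power)
  then show "L2_rel (\<lambda>z. z ^ n *\<^sub>C x) (\<lambda>z. z ^ n *\<^sub>C x)"
    by (auto simp: L2_rel_def intro!: square_integrable_scaleC_fun square_integrable_const)
qed

lift_definition mult_z :: "'a::complex_inner L2_circle \<Rightarrow> 'a L2_circle" is "\<lambda>f z. z *\<^sub>C f z"
proof -
  fix f g :: "complex \<Rightarrow> 'a"
  assume "L2_rel f g"
  then show "L2_rel (\<lambda>z. z *\<^sub>C f z) (\<lambda>z. z *\<^sub>C g z)"
    by (auto simp: L2_rel_def elim: eventually_mono
        intro!: square_integrable_scaleC_fun[OF _ _ AE_circle_norm])
qed

text \<open>\<open>H\<^sup>2\<^sub>+(T) \<otimes> L\<close>, realised inside \<open>L\<^sup>2(T) \<otimes> L = L\<^sup>2(T; L)\<close>: the closed linear span of the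
  functions \<open>z \<mapsto> z\<^sup>n x\<close> with \<open>n \<ge> 1\<close> and \<open>x \<in> L\<close>.\<close>

definition H_plus :: "'a::complex_inner L2_circle set" where
  "H_plus = closure (complex_vector.span {monomial_L2 n x | n x. n \<ge> 1})"

end

theory Submission
  imports Defs
begin

text \<open>Put \<open>R = S\<^sub>0\<^sup>*\<close> and \<open>T x = (S\<^sub>j\<^sup>* x)\<^sub>j\<close> for \<open>j \<ge> 1\<close>. The Cuntz relations give
  \<open>\<parallel>x\<parallel>\<^sup>2 = \<parallel>R x\<parallel>\<^sup>2 + \<parallel>T x\<parallel>\<^sup>2\<close>, hence
  \<open>\<parallel>x\<parallel>\<^sup>2 = \<parallel>T x\<parallel>\<^sup>2 + \<dots> + \<parallel>T R\<^sup>n x\<parallel>\<^sup>2 + \<parallel>R\<^sup>n\<^sup>+\<^sup>1 x\<parallel>\<^sup>2\<close>,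
  and the remainder tends to \<open>0\<close> because \<open>S\<^sub>0\<close> is a shift. So \<open>U x = \<Sum>\<^sub>k z\<^sup>k\<^sup>+\<^sup>1 T R\<^sup>k x\<close> is an
  isometry from \<open>K\<close> into \<open>H\<^sub>+\<close>. It intertwines \<open>S\<^sub>0\<close> with multiplication by \<open>z\<close> and sends \<open>S\<^sub>j x\<close>
  to \<open>z\<close> times \<open>x\<close> in slot \<open>j\<close>; therefore its closed range contains all monomials, and
  \<open>V = U\<^sup>-\<^sup>1\<close> is the required unitary.\<close>

section \<open>Adjoints\<close>

instance chilbert_space \<subseteq> banach ..

text \<open>The representing vector is found as the minimiser of the functional \<open>J\<close>:
  the vanishing of its first variation at the minimum is exactly the required identity.\<close>

lemma riesz_representation:
  fixes \<phi> :: "'a::{real_inner, complete_space} \<Rightarrow> real"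
  assumes "bounded_linear \<phi>"
  shows "\<exists>x. \<forall>g. inner x g = \<phi> g"
proof -
  interpret bounded_linear \<phi> by fact
  define J where "J x = (norm x)\<^sup>2 - 2 * \<phi> x" for x
  define m where "m = Inf (range J)"
  obtain K where K: "\<And>x. \<bar>\<phi> x\<bar> \<le> norm x * K" using bounded by auto
  have "- K\<^sup>2 \<le> J x" for x
  proof -
    have "0 \<le> (norm x - K)\<^sup>2" by simp
    then show ?thesis using K[of x] by (simp add: J_def power2_diff abs_le_iff)
  qed
  then have "bdd_below (range J)" by (auto intro!: bdd_belowI)
  then have m: "m \<le> J x" for x unfolding m_def by (simp add: cInf_lower)
  have "\<exists>x. J x < m + 1 / real (Suc n)" for n
    using cInf_lessD[of "range J" "m + 1 / real (Suc n)"] by (auto simp: m_def)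
  then obtain X where X: "\<And>n. J (X n) < m + 1 / real (Suc n)" by metis
  \<comment> \<open>by the parallelogram law, minimising sequences of \<open>J\<close> are Cauchy\<close>
  have par: "(dist x y)\<^sup>2 \<le> 2 * (J x - m) + 2 * (J y - m)" for x y
  proof -
    have "(dist x y)\<^sup>2 = 2 * J x + 2 * J y - 4 * J ((1/2) *\<^sub>R (x + y))"
      by (simp add: J_def dist_norm power2_norm_eq_inner inner_diff inner_add scaleR add
          inner_commute algebra_simps)
    with m[of "(1/2) *\<^sub>R (x + y)"] show ?thesis by simp
  qed
  have "Cauchy X"
  proof (rule metric_CauchyI)
    fix e :: real assume "e > 0"
    then obtain M where M: "1 / real (Suc M) < e\<^sup>2 / 4"
      using nat_approx_posE[of "e\<^sup>2 / 4"] by auto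
    have "dist (X i) (X j) < e" if "i \<ge> M" "j \<ge> M" for i j
    proof -
      have "1 / real (Suc i) \<le> 1 / real (Suc M)" "1 / real (Suc j) \<le> 1 / real (Suc M)"
        using that by (auto simp: field_simps)
      with X[of i] X[of j] M have "J (X i) < m + e\<^sup>2 / 4" "J (X j) < m + e\<^sup>2 / 4"
        by (metis add_left_mono order_le_less_trans order_less_trans add_strict_left_mono)+
      then have "2 * (J (X i) - m) + 2 * (J (X j) - m) < 2 * (e\<^sup>2 / 4) + 2 * (e\<^sup>2 / 4)"
        by (intro add_strict_mono mult_strict_left_mono) auto
      with par[of "X i" "X j"] have "(dist (X i) (X j))\<^sup>2 < e\<^sup>2" by simp
      with \<open>e > 0\<close> show ?thesis by (simp add: power_less_imp_less_base)
    qed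
    then show "\<exists>M. \<forall>i\<ge>M. \<forall>j\<ge>M. dist (X i) (X j) < e" by blast
  qed
  then obtain x where x: "X \<longlonglongrightarrow> x" using Cauchy_convergent convergent_def by blast
  have "(\<lambda>n. J (X n)) \<longlonglongrightarrow> J x"
    unfolding J_def by (intro tendsto_intros tendsto x)
  moreover have "(\<lambda>n. m + 1 / real (Suc n)) \<longlonglongrightarrow> m + 0"
    by (intro tendsto_intros LIMSEQ_Suc[OF lim_1_over_n])
  ultimately have Jx: "J x \<le> m"
    using X by (metis (no_types, lifting) LIMSEQ_le add.right_neutral less_imp_le)
  have "inner x g = \<phi> g" for g
  proof (cases "g = 0")
    case False
    \<comment> \<open>\<open>c\<close> is half the derivative of \<open>J\<close> at
      \<open>x\<close> in direction \<open>g\<close>, and \<open>t\<close> below minimises the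
      quadratic polynomial \<open>J (x + t *\<^sub>R g)\<close> in \<open>t\<close>. The gain would
      be strict unless \<open>c\<close> vanishes.\<close>
    define c where "c = inner x g - \<phi> g"
    define t where "t = - c / (norm g)\<^sup>2"
    have "J (x + t *\<^sub>R g) = J x + t\<^sup>2 * (norm g)\<^sup>2 + 2 * t * c"
      by (simp add: J_def c_def power2_norm_eq_inner inner_add inner_commute add scaleR
          algebra_simps power2_eq_square[of t])
    also have "\<dots> = J x - c\<^sup>2 / (norm g)\<^sup>2"
      using False by (simp add: t_def power2_eq_square)
    finally have "c\<^sup>2 / (norm g)\<^sup>2 \<le> 0" using m[of "x + t *\<^sub>R g"] Jx by linarith
    then have "c = 0" using False by (simp add: divide_le_0_iff)
    then show ?thesis by (simp add: c_def)
  qed (simp add: zero)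
  then show ?thesis by blast
qed

text \<open>Replacing \<open>g\<close> by \<open>\<i> *\<^sub>C g\<close> recovers the imaginary
  part, so the real Riesz vector also represents a complex linear functional.\<close>

lemma cinner_eq_if_inner_eq:
  fixes \<phi> :: "'a::complex_inner \<Rightarrow> complex"
  assumes "\<And>g. inner x g = Re (\<phi> g)" and "\<And>c g. \<phi> (c *\<^sub>C g) = c * \<phi> g"
  shows "cinner x g = \<phi> g"
  using assms(1)[of g] assms(1)[of "\<i> *\<^sub>C g"]
  by (simp add: inner_eq_Re_cinner cinner_scaleC_right assms(2) complex_eq_iff)

lemma cinner_zero_left [simp]: "cinner 0 x = 0"
  by (rule bounded_bilinear.zero_left[OF bounded_bilinear_cinner])

lemma cinner_zero_right [simp]: "cinner x 0 = 0"
  by (rule bounded_bilinear.zero_right[OF bounded_bilinear_cinner])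

lemma cinner_diff_left: "cinner (x - y) z = cinner x z - cinner y z"
  by (rule bounded_bilinear.diff_left[OF bounded_bilinear_cinner])

lemma cinner_sum_left: "cinner (\<Sum>i\<in>A. f i) y = (\<Sum>i\<in>A. cinner (f i) y)"
  by (rule bounded_bilinear.sum_left[OF bounded_bilinear_cinner])

lemma cinner_sum_right: "cinner x (\<Sum>i\<in>A. f i) = (\<Sum>i\<in>A. cinner x (f i))"
  by (rule bounded_bilinear.sum_right[OF bounded_bilinear_cinner])

lemma scaleC_minus_one: "(- 1) *\<^sub>C x = - x"
  using scaleR_scaleC[of "- 1" x] by simp

lemma norm_eq_if_cinner_eq:
  "cinner x x = cinner y y \<Longrightarrow> norm x = norm y"
  unfolding cinner_self of_real_eq_iff by (simp add: power2_eq_iff_nonneg)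

text \<open>Uniqueness behind the \<open>THE\<close>: the difference of two candidates lies in
  \<open>H\<close> again and is therefore orthogonal to itself.\<close>

lemma cadjoint_on_eqI:
  assumes "x \<in> H" "\<And>g. g \<in> H \<Longrightarrow> cinner x g = cinner y (T g)"
    and diff: "\<And>f g. f \<in> H \<Longrightarrow> g \<in> H \<Longrightarrow> f - g \<in> H"
  shows "cadjoint_on H T y = x"
  unfolding cadjoint_on_def
proof (rule the_equality)
  fix x' assume x': "x' \<in> H \<and> (\<forall>g\<in>H. cinner x' g = cinner y (T g))"
  then have "cinner (x' - x) (x' - x) = 0"
    using assms(1,2) diff by (simp add: cinner_diff_left)
  then show "x' = x" by (simp add: cinner_self)
qed (use assms in auto)

text \<open>Existence behind the \<open>THE\<close>: Riesz representation is applied to the real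
  part of the functional on the right.\<close>

lemma cinner_cadjoint:
  fixes T :: "'a::chilbert_space \<Rightarrow> 'b::complex_inner"
  assumes "bounded_clinear T"
  shows "cinner (cadjoint T y) g = cinner y (T g)"
proof -
  have T: "bounded_linear T" "\<And>c g. T (c *\<^sub>C g) = c *\<^sub>C T g"
    using assms by (auto simp: bounded_clinear_def)
  have "bounded_linear (\<lambda>g. Re (cinner y (T g)))"
    by (rule bounded_linear_compose[OF bounded_linear_Re])
      (rule bounded_linear_compose[OF
          bounded_bilinear.bounded_linear_right[OF bounded_bilinear_cinner] T(1)])
  then obtain x where x: "\<And>g. inner x g = Re (cinner y (T g))"
    using riesz_representation by blast
  have adj: "cinner x g = cinner y (T g)" for g
    by (rule cinner_eq_if_inner_eq[OF x]) (simp add: T(2) cinner_scaleC_right)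
  then have "cadjoint T y = x" by (intro cadjoint_on_eqI) auto
  with adj show ?thesis by simp
qed

lemma bounded_clinear_cadjoint:
  fixes T :: "'a::chilbert_space \<Rightarrow> 'b::complex_inner"
  assumes "bounded_clinear T"
  shows "cadjoint T (x + y) = cadjoint T x + cadjoint T y"
    and "cadjoint T (c *\<^sub>C x) = c *\<^sub>C cadjoint T x"
  by (auto intro!: cadjoint_on_eqI simp: cinner_add_left cinner_scaleC_left cinner_cadjoint[OF assms])

text \<open>By Pythagoras, the squared norm of a block of the series is the corresponding block of
  the scalar series, so the Cauchy criterion carries over. This handles the series for
  \<open>U\<close>, whose terms are only known to be square summable.\<close>

lemma summable_orthogonal:
  fixes f :: "nat \<Rightarrow> 'a::{real_inner, banach}"
  assumes orth: "\<And>i j. i \<noteq> j \<Longrightarrow> inner (f i) (f j) = 0"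
    and sq: "summable (\<lambda>n. (norm (f n))\<^sup>2)"
  shows "summable f"
proof -
  have pyth: "(norm (sum f {m..<n}))\<^sup>2 = (\<Sum>k=m..<n. (norm (f k))\<^sup>2)" for m n
    by (rule norm_sum_Pythagorean) (auto simp: pairwise_def orthogonal_def orth)
  show ?thesis
    unfolding summable_Cauchy
  proof (intro allI impI)
    fix e :: real assume "e > 0"
    then obtain N where N: "\<And>m n. m \<ge> N \<Longrightarrow> norm (\<Sum>k=m..<n. (norm (f k))\<^sup>2) < e\<^sup>2"
      using sq unfolding summable_Cauchy by (metis zero_less_power)
    have "norm (sum f {m..<n}) < e" if "m \<ge> N" for m n
      by (rule power_less_imp_less_base[of _ 2])
        (use N[OF that, of n] \<open>e > 0\<close> in \<open>auto simp: pyth sum_nonneg\<close>)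
    then show "\<exists>N. \<forall>m\<ge>N. \<forall>n. norm (sum f {m..<n}) < e" by blast
  qed
qed

section \<open>Completeness of the space of square integrable functions\<close>

text \<open>One direction of Pettis' theorem. Nearest points in growing finite parts of
  \<open>D\<close> give simple functions; breaking ties by the least index keeps the choice
  measurable.\<close>

lemma strongly_measurable_separable:
  fixes f :: "'a \<Rightarrow> 'b::metric_space"
  assumes f: "f \<in> borel_measurable M" and D: "countable D" "f ` space M \<subseteq> closure D"
  shows "strongly_measurable M f"
proof (cases "space M = {}")
  case True
  then show ?thesis
    by (auto simp: strongly_measurable_def simple_function_def intro!: exI[of _ "\<lambda>_ _. undefined"])
next
  case False
  with D have "D \<noteq> {}" by auto
  with D(1) obtain d :: "nat \<Rightarrow> 'b" where d: "range d = D" by (metis range_from_nat_into)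
  \<comment> \<open>\<open>d (j n x)\<close> is the closest point to \<open>f x\<close> among the first \<open>n + 1\<close> points of \<open>D\<close>\<close>
  define j where "j n x = (LEAST k. k \<le> n \<and> (\<forall>i\<in>{..n}. dist (f x) (d k) \<le> dist (f x) (d i)))" for n x
  have j: "j n x \<le> n \<and> (\<forall>i\<in>{..n}. dist (f x) (d (j n x)) \<le> dist (f x) (d i))" for n x
  proof -
    let ?k = "arg_min_on (\<lambda>i. dist (f x) (d i)) {..n}"
    have "?k \<in> {..n}" by (rule arg_min_if_finite) auto
    moreover have "\<forall>i\<in>{..n}. dist (f x) (d ?k) \<le> dist (f x) (d i)"
      by (intro ballI arg_min_least) auto
    ultimately show ?thesis 
      unfolding j_def
      using LeastI[of "\<lambda>k. k \<le> n \<and> (\<forall>i\<in>{..n}. dist (f x) (d k) \<le> dist (f x) (d i))" ?k]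
      by simp
  qed
  have jm: "j n \<in> measurable M (count_space UNIV)" for n
  proof -
    have [measurable]: "(\<lambda>x. dist (f x) (d k)) \<in> borel_measurable M" for k
      by (rule measurable_compose[OF f])
        (intro borel_measurable_continuous_onI continuous_intros)
    show ?thesis unfolding j_def by measurable
  qed
  have "simple_function M (j n)" for n
    unfolding simple_function_def
  proof
    show "finite (j n ` space M)"
      by (rule finite_subset[of _ "{..n}"]) (use j in auto)
    show "\<forall>x\<in>j n ` space M. j n -` {x} \<inter> space M \<in> sets M"
      using measurable_sets[OF jm] by auto
  qed
  then have "simple_function M (\<lambda>x. d (j n x))" for n
    using simple_function_compose[of M "j n" d] by (simp add: comp_def)
  moreover have "(\<lambda>n. d (j n x)) \<longlonglongrightarrow> f x" if x: "x \<in> space M" for x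
  proof (rule metric_LIMSEQ_I)
    fix e :: real assume "e > 0"
    then obtain i where "dist (d i) (f x) < e"
      using D(2) x d unfolding closure_approachable image_subset_iff by blast
    with j show "\<exists>no. \<forall>n\<ge>no. dist (d (j n x)) (f x) < e"
      by (intro exI[of _ i]) (metis atMost_iff dist_commute order_le_less_trans)
  qed
  ultimately show ?thesis
    unfolding strongly_measurable_def by (intro exI[of _ "\<lambda>n x. d (j n x)"]) simp
qed

text \<open>A diagonal sequence of the simple functions need not converge pointwise. Instead, all
  their values together form a countable set whose closure contains the range of the limit, so the
  separability criterion applies.\<close>

lemma strongly_measurable_LIMSEQ:
  fixes f :: "nat \<Rightarrow> 'a \<Rightarrow> 'b::metric_space"
  assumes f: "\<And>k. strongly_measurable M (f k)"
    and lim: "\<And>x. x \<in> space M \<Longrightarrow> (\<lambda>k. f k x) \<longlonglongrightarrow> g x"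
  shows "strongly_measurable M g"
proof -
  from f obtain s where s: "\<And>k n. simple_function M (s k n)"
    "\<And>k x. x \<in> space M \<Longrightarrow> (\<lambda>n. s k n x) \<longlonglongrightarrow> f k x"
    unfolding strongly_measurable_def by metis
  define D where "D = (\<Union>k n. s k n ` space M)"
  have "countable D"
    unfolding D_def using s(1) 
    by (intro countable_UN countableI_type countable_finite[OF simple_functionD(1)[OF s(1)]])
  moreover have "g ` space M \<subseteq> closure D"
  proof
    fix y assume "y \<in> g ` space M"
    then obtain x where x: "x \<in> space M" "y = g x" by auto
    have "f k x \<in> closure D" for k
      using s(2)[OF x(1)] x(1)
      by (intro closed_sequentially[OF closed_closure _ s(2)[OF x(1)]] subsetD[OF closure_subset])
         (auto simp: D_def)
    with lim[OF x(1)] show "y \<in> closure D"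
      unfolding x(2) by (rule closed_sequentially[OF closed_closure, rotated])
  qed
  moreover have "g \<in> borel_measurable M"
    using f lim by (blast intro: borel_measurable_LIMSEQ_metric strongly_measurable_borel)
  ultimately show ?thesis by (blast intro: strongly_measurable_separable)
qed

section \<open>Distances in \<open>L2_circle\<close> as integrals\<close>

lemma square_integrable_diff:
  fixes f g :: "complex \<Rightarrow> 'a::complex_inner"
  assumes "square_integrable f" "square_integrable g"
  shows "square_integrable (\<lambda>z. f z - g z)"
  using square_integrable_add[OF assms(1) square_integrable_scaleC[OF assms(2), of "- 1"]]
  by (simp add: scaleC_minus_one)

lemma norm_abs_L2_circle:
  assumes "square_integrable F"
  shows "(norm (abs_L2_circle F))\<^sup>2 = (\<integral>z. (norm (F z))\<^sup>2 \<partial>circle_measure)"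
proof -
  have "complex_of_real ((norm (abs_L2_circle F))\<^sup>2) = (\<integral>z. cinner (F z) (F z) \<partial>circle_measure)"
    unfolding cinner_self[symmetric]
    by (rule cinner_L2_circle.abs_eq) (use assms in \<open>auto simp: L2_rel_def\<close>)
  then show ?thesis by (simp add: cinner_self del: of_real_power)
qed

lemma diff_abs_L2_circle:
  assumes "square_integrable F" "square_integrable G"
  shows "abs_L2_circle F - abs_L2_circle G = abs_L2_circle (\<lambda>z. F z - G z)"
proof -
  have "L2_rel F F" "L2_rel G G" "L2_rel (\<lambda>z. (- 1) *\<^sub>C G z) (\<lambda>z. (- 1) *\<^sub>C G z)"
    using assms square_integrable_scaleC[OF assms(2), of "- 1"] by (auto simp: L2_rel_def)
  then have "abs_L2_circle F + (- 1) *\<^sub>C abs_L2_circle G =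
      abs_L2_circle (\<lambda>z. F z + (- 1) *\<^sub>C G z)"
    by (simp only: scaleC_L2_circle.abs_eq plus_L2_circle.abs_eq)
  then show ?thesis by (simp add: scaleC_minus_one)
qed

text \<open>The nonnegative integral is the form in which termwise integration of series and Fatou's
  lemma apply.\<close>

lemma nn_integral_eq_dist_L2_circle:
  assumes "square_integrable F" "square_integrable G"
  shows "(\<integral>\<^sup>+z. ennreal ((norm (F z - G z))\<^sup>2) \<partial>circle_measure) =
    ennreal ((dist (abs_L2_circle F) (abs_L2_circle G))\<^sup>2)"
  using square_integrable_diff[OF assms]
  unfolding dist_norm diff_abs_L2_circle[OF assms]
  by (simp add: norm_abs_L2_circle nn_integral_eq_integral square_integrable_def)

lemma emeasure_circle: "emeasure circle_measure UNIV = 1"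
  unfolding circle_measure_def
  by (subst emeasure_distr[OF measurable_circle_param]) (simp_all add: emeasure_restrict_space)

lemma L2_circle_rep:
  "square_integrable (rep_L2_circle f)" "abs_L2_circle (rep_L2_circle f) = f"
  using Quotient_rep_reflp[OF Quotient_L2_circle, of f] Quotient_abs_rep[OF Quotient_L2_circle, of f]
  by (auto simp: L2_rel_def)

text \<open>The geometric rate makes the integrals of the increments summable, so the telescoping
  series converges absolutely at almost every point.\<close>

lemma L2_circle_fast_Cauchy_AE:
  fixes F :: "nat \<Rightarrow> complex \<Rightarrow> 'a::chilbert_space"
  assumes F: "\<And>k. square_integrable (F k)"
    and D: "\<And>k. dist (abs_L2_circle (F k)) (abs_L2_circle (F (Suc k))) \<le> (1/2) ^ k"
  shows "AE z in circle_measure. convergent (\<lambda>k. F k z)"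
proof -
  define D where "D k z = norm (F k z - F (Suc k) z)" for k z
  have meas [measurable]: "F k \<in> borel_measurable circle_measure" for k
    using F by (auto simp: square_integrable_def intro: strongly_measurable_borel)
  have sm: "strongly_measurable circle_measure (\<lambda>z. F k z - F (Suc k) z)" for k
    using square_integrable_diff[OF F F] by (auto simp: square_integrable_def)
  have Dm [measurable]: "D k \<in> borel_measurable circle_measure" for k
    unfolding D_def using strongly_measurable_borel[OF sm] by measurable
  \<comment> \<open>AM-GM replaces the Cauchy-Schwarz inequality for integrals\<close>
  have D_le: "D k z \<le> 2 ^ k * (D k z)\<^sup>2 + (1/2) ^ k" for k z
  proof -
    have "0 \<le> (2 ^ k * D k z - 1)\<^sup>2" "0 \<le> 2 ^ k * D k z" by (simp_all add: D_def)
    then have "2 ^ k * D k z \<le> 2 ^ k * (2 ^ k * (D k z)\<^sup>2 + (1/2) ^ k)"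
      by (simp add: power2_eq_square algebra_simps power_one_over)
    then show ?thesis by simp
  qed
  have "(\<integral>\<^sup>+z. ennreal (D k z) \<partial>circle_measure) \<le> ennreal (2 * (1/2) ^ k)" for k
  proof -
    have "(\<integral>\<^sup>+z. ennreal (D k z) \<partial>circle_measure) \<le>
        (\<integral>\<^sup>+z. ennreal (2 ^ k) * ennreal ((D k z)\<^sup>2) + ennreal ((1/2) ^ k) \<partial>circle_measure)"
      by (intro nn_integral_mono) (simp add: D_le flip: ennreal_mult ennreal_plus)
    also have "\<dots> = ennreal (2 ^ k) * (\<integral>\<^sup>+z. ennreal ((D k z)\<^sup>2) \<partial>circle_measure) + ennreal ((1/2) ^ k)"
      by (subst nn_integral_add) (simp_all add: nn_integral_cmult emeasure_circle)
    also have "\<dots> \<le> ennreal (2 ^ k) * ennreal (((1/2) ^ k)\<^sup>2) + ennreal ((1/2) ^ k)"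
      unfolding D_def nn_integral_eq_dist_L2_circle[OF F F]
      by (intro add_mono mult_left_mono ennreal_leI power_mono D) auto
    also have "\<dots> = ennreal (2 * (1/2) ^ k)"
      by (simp add: power2_eq_square power_one_over flip: ennreal_mult ennreal_plus)
    finally show ?thesis .
  qed
  then have "(\<Sum>k. \<integral>\<^sup>+z. ennreal (D k z) \<partial>circle_measure) \<le> (\<Sum>k. ennreal (2 * (1/2) ^ k))"
    by (intro suminf_le) auto
  also have "\<dots> < \<infinity>"
    by (subst suminf_ennreal2) (auto intro!: summable_mult summable_geometric)
  finally have "(\<integral>\<^sup>+z. (\<Sum>k. ennreal (D k z)) \<partial>circle_measure) \<noteq> \<infinity>"
    by (simp add: nn_integral_suminf)
  then have "AE z in circle_measure. (\<Sum>k. ennreal (D k z)) \<noteq> \<infinity>"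
    by (intro nn_integral_PInf_AE) auto
  then show ?thesis
  proof eventually_elim
    case (elim z)
    then have "summable (\<lambda>k. norm (F (Suc k) z - F k z))"
      by (intro summable_suminf_not_top) (auto simp: D_def norm_minus_commute)
    then have "summable (\<lambda>k. F (Suc k) z - F k z)" by (rule summable_norm_cancel)
    then have "convergent (\<lambda>n. F n z - F 0 z)"
      unfolding summable_iff_convergent sum_lessThan_telescope[of "\<lambda>k. F k z"] .
    then have "convergent (\<lambda>n. F n z - F 0 z + F 0 z)"
      by (intro convergent_add convergent_const)
    then show ?case by simp
  qed
qed


text \<open>Riesz-Fischer: a fast Cauchy subsequence has a pointwise limit almost everywhere,
  Fatou's lemma turns it into a limit in norm, and the whole Cauchy sequence follows. The
  convergence of the series for \<open>U\<close> rests on this completeness.\<close>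

instance L2_circle :: (chilbert_space) chilbert_space
proof
  fix X :: "nat \<Rightarrow> 'a L2_circle"
  assume "Cauchy X"
  then have "\<exists>M. \<forall>m\<ge>M. \<forall>n\<ge>M. dist (X m) (X n) < (1/2) ^ k" for k
    by (rule metric_CauchyD) simp
  then obtain M where M: "\<And>k m n. m \<ge> M k \<Longrightarrow> n \<ge> M k \<Longrightarrow> dist (X m) (X n) < (1/2) ^ k"
    by metis
  \<comment> \<open>The sum dominates every \<open>M i\<close> with \<open>i \<le> k\<close>, so
    \<open>r k\<close> meets all earlier tolerances as well.\<close>
  define r where "r k = (\<Sum>i\<le>k. M i)" for k
  have r_ge: "r j \<ge> M k" if "k \<le> j" for j k
    unfolding r_def using that by (intro member_le_sum) auto
  define F where "F k = rep_L2_circle (X (r k))" for k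
  have F: "square_integrable (F k)" "abs_L2_circle (F k) = X (r k)" for k
    by (simp_all add: F_def L2_circle_rep)
  have "AE z in circle_measure. convergent (\<lambda>k. F k z)"
    by (rule L2_circle_fast_Cauchy_AE) (auto simp: F intro!: less_imp_le M r_ge)
  then obtain N where N: "{z. \<not> convergent (\<lambda>k. F k z)} \<subseteq> N" "N \<in> null_sets circle_measure"
    by (auto elim!: AE_E simp: null_sets_def)
  \<comment> \<open>Cutting off the null set \<open>N\<close> makes the sequence converge at every
    point, as strong measurability demands.\<close>
  define f where "f z = lim (\<lambda>k. indicator (- N) z *\<^sub>C F k z)" for z
  have lim: "(\<lambda>k. indicator (- N) z *\<^sub>C F k z) \<longlonglongrightarrow> f z" for z
    unfolding f_def convergent_LIMSEQ_iff[symmetric]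
    using N(1) by (cases "z \<in> N") (auto simp: scaleC_one convergent_const)
  have sm_F: "strongly_measurable circle_measure (F k)" for k
    using F(1) by (simp add: square_integrable_def)
  have sm_f: "strongly_measurable circle_measure f"
  proof (rule strongly_measurable_LIMSEQ)
    show "strongly_measurable circle_measure (\<lambda>z. indicator (- N) z *\<^sub>C F k z)" for k
      using N(2) by (intro strongly_measurable_scaleC sm_F borel_strongly_measurable
          borel_measurable_indicator) (auto dest: null_setsD2)
  qed (rule lim)
  have "AE z in circle_measure. z \<notin> N" using N(2) by (rule AE_not_in)
  then have lim_AE: "AE z in circle_measure. (\<lambda>k. F k z) \<longlonglongrightarrow> f z"
  proof eventually_elim
    case (elim z)
    with lim[of z] show ?case by (simp add: scaleC_one)
  qed
  have sm_diff: "strongly_measurable circle_measure (\<lambda>z. F k z - f z)" for k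
    using strongly_measurable_compose2[OF sm_F sm_f, of "\<lambda>x y. x - y"] by (simp add: tendsto_diff)
  \<comment> \<open>\<open>k\<close> stays fixed while \<open>m\<close> tends to infinity in the
    Cauchy estimate for \<open>F k - F m\<close>.\<close>
  have Fatou: "(\<integral>\<^sup>+z. ennreal ((norm (F k z - f z))\<^sup>2) \<partial>circle_measure) \<le> ennreal (((1/2) ^ k)\<^sup>2)" for k
  proof -
    have [measurable]: "(\<lambda>z. F k z - F m z) \<in> borel_measurable circle_measure" for m
      using square_integrable_diff[OF F(1) F(1)]
      by (auto simp: square_integrable_def intro: strongly_measurable_borel)
    have "AE z in circle_measure. ennreal ((norm (F k z - f z))\<^sup>2) =
        liminf (\<lambda>m. ennreal ((norm (F k z - F m z))\<^sup>2))"
      using lim_AE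
    proof eventually_elim
      case (elim z)
      then have "(\<lambda>m. ennreal ((norm (F k z - F m z))\<^sup>2)) \<longlonglongrightarrow> ennreal ((norm (F k z - f z))\<^sup>2)"
        by (intro tendsto_ennrealI tendsto_intros)
      then show ?case by (rule lim_imp_Liminf[OF sequentially_bot, symmetric])
    qed
    then have "(\<integral>\<^sup>+z. ennreal ((norm (F k z - f z))\<^sup>2) \<partial>circle_measure) =
        (\<integral>\<^sup>+z. liminf (\<lambda>m. ennreal ((norm (F k z - F m z))\<^sup>2)) \<partial>circle_measure)"
      by (rule nn_integral_cong_AE)
    also have "\<dots> \<le> liminf (\<lambda>m. \<integral>\<^sup>+z. ennreal ((norm (F k z - F m z))\<^sup>2) \<partial>circle_measure)"
      by (rule nn_integral_liminf) measurable
    also have "\<dots> \<le> liminf (\<lambda>m. ennreal (((1/2) ^ k)\<^sup>2))"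
    proof (rule Liminf_mono)
      have "(dist (X (r k)) (X (r m)))\<^sup>2 \<le> ((1/2) ^ k)\<^sup>2" if "m \<ge> k" for m
        using less_imp_le[OF M[OF r_ge[OF order_refl] r_ge[OF that]]] by (intro power_mono) auto
      then show "\<forall>\<^sub>F m in sequentially. (\<integral>\<^sup>+z. ennreal ((norm (F k z - F m z))\<^sup>2) \<partial>circle_measure)
          \<le> ennreal (((1/2) ^ k)\<^sup>2)"
        unfolding nn_integral_eq_dist_L2_circle[OF F(1) F(1)] F(2) eventually_sequentially
        by (intro exI[of _ k]) (simp add: ennreal_leI)
    qed
    also have "\<dots> = ennreal (((1/2) ^ k)\<^sup>2)" by (simp add: Liminf_const)
    finally show ?thesis .
  qed
  have si_diff: "square_integrable (\<lambda>z. F k z - f z)" for k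
    unfolding square_integrable_def
  proof
    show "integrable circle_measure (\<lambda>z. (norm (F k z - f z))\<^sup>2)"
      using strongly_measurable_borel[OF sm_diff, of k]
      by (intro integrableI_nonneg) (auto intro: order_le_less_trans[OF Fatou])
  qed (rule sm_diff)
  \<comment> \<open>\<open>f\<close> is written as \<open>F 0 - (F 0 - f)\<close>.\<close>
  have si_f: "square_integrable f"
    using square_integrable_diff[OF F(1) si_diff, of 0 0] by simp
  have dist_f: "dist (X (r k)) (abs_L2_circle f) \<le> (1/2) ^ k" for k
  proof (rule power2_le_imp_le)
    show "(dist (X (r k)) (abs_L2_circle f))\<^sup>2 \<le> ((1/2) ^ k)\<^sup>2"
      using Fatou[of k] unfolding nn_integral_eq_dist_L2_circle[OF F(1) si_f] F(2)
      by (subst (asm) ennreal_le_iff) auto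
  qed simp
  have "X \<longlonglongrightarrow> abs_L2_circle f"
  proof (rule metric_LIMSEQ_I)
    fix e :: real assume "e > 0"
    then obtain k where k: "(1/2) ^ k < e / 2"
      using real_arch_pow_inv[of "e / 2" "1/2"] by auto
    have "dist (X n) (abs_L2_circle f) < e" if "n \<ge> r k" for n
    proof -
      have "dist (X n) (X (r k)) < (1/2) ^ k"
        using that r_ge[of k k] by (intro M) auto
      with dist_f[of k] k dist_triangle[of "X n" "abs_L2_circle f" "X (r k)"] show ?thesis
        by linarith
    qed
    then show "\<exists>no. \<forall>n\<ge>no. dist (X n) (abs_L2_circle f) < e" by blast
  qed
  then show "convergent X" by (rule convergentI)
qed

section \<open>Monomials and multiplication by \<open>z\<close>\<close>

text \<open>For nonzero \<open>k\<close> the primitive \<open>cis (c * t) / (\<i> * c)\<close> takes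
  the same value at both ends of the interval.\<close>

lemma integral_cis_int:
  "(\<integral>t. cis (2 * pi * real_of_int k * t) \<partial>restrict_space lborel {0..1}) = (if k = 0 then 1 else 0)"
proof (cases "k = 0")
  case False
  define c where "c = 2 * pi * real_of_int k"
  have c: "c \<noteq> 0" using False by (simp add: c_def)
  have cont: "continuous_on {0..1} (\<lambda>t. cis (c * t))" by (intro continuous_intros)
  have "((\<lambda>t. cis (c * t)) has_integral cis (c * 1) / (\<i> * c) - cis (c * 0) / (\<i> * c)) {0..1}"
  proof (rule fundamental_theorem_of_calculus)
    fix t :: real
    show "((\<lambda>t. cis (c * t) / (\<i> * c)) has_vector_derivative cis (c * t)) (at t within {0..1})"
    proof -
      have "((\<lambda>w. exp (\<i> * c * w) / (\<i> * c)) has_field_derivative exp (\<i> * c * t)) (at (of_real t))"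
        using c by (auto intro!: derivative_eq_intros)
      from has_vector_derivative_real_field[OF this] show ?thesis
        by (simp add: cis_conv_exp mult.assoc)
    qed
  qed simp
  moreover have "cis (c * 1) = 1"
    using cis_multiple_2pi[of "real_of_int k"] by (simp add: c_def mult_ac)
  ultimately have "integral {0..1} (\<lambda>t. cis (c * t)) = 0" by (simp add: integral_unique)
  then have "(LINT t:{0..1}|lborel. cis (c * t)) = 0"
    using set_borel_integral_eq_integral(2)[OF borel_integrable_atLeastAtMost'[OF cont]] by simp
  then show ?thesis
    using False by (simp add: integral_restrict_space set_lebesgue_integral_def c_def)
qed (simp add: measure_restrict_space)

lemma integral_circle_powers:
  "(\<integral>z. cnj (z ^ m) * z ^ n \<partial>circle_measure) = (if m = n then 1 else 0)"
proof -
  have "(\<integral>z. cnj (z ^ m) * z ^ n \<partial>circle_measure) =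
      (\<integral>t. cnj (cis (2 * pi * t) ^ m) * cis (2 * pi * t) ^ n \<partial>restrict_space lborel {0..1})"
    unfolding circle_measure_def
    by (rule integral_distr[OF measurable_circle_param])
      (intro borel_measurable_continuous_onI continuous_intros)
  also have "\<dots> = (\<integral>t. cis (2 * pi * real_of_int (int n - int m) * t) \<partial>restrict_space lborel {0..1})"
    by (intro Bochner_Integration.integral_cong refl)
      (simp add: Complex.DeMoivre cis_cnj cis_mult algebra_simps)
  also have "\<dots> = (if m = n then 1 else 0)"
    unfolding integral_cis_int by simp
  finally show ?thesis .
qed

lemma square_integrable_monomial: "square_integrable (\<lambda>z. z ^ n *\<^sub>C x)"
proof -
  have "AE z in circle_measure. cmod (z ^ n) = 1"
    using AE_circle_norm by eventually_elim (simp add: norm_power)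
  then show ?thesis by (intro square_integrable_scaleC_fun square_integrable_const) auto
qed

lemma cinner_monomial_L2:
  "cinner (monomial_L2 m x) (monomial_L2 n y) = (if m = n then cinner x y else 0)"
proof -
  have "cinner (monomial_L2 m x) (monomial_L2 n y) =
      (\<integral>z. cinner (z ^ m *\<^sub>C x) (z ^ n *\<^sub>C y) \<partial>circle_measure)"
    by transfer simp
  also have "\<dots> = (\<integral>z. cnj (z ^ m) * z ^ n * cinner x y \<partial>circle_measure)"
    by (simp add: cinner_scaleC_left cinner_scaleC_right mult_ac)
  also have "\<dots> = (\<integral>z. cnj (z ^ m) * z ^ n \<partial>circle_measure) * cinner x y"
    by (rule Bochner_Integration.integral_mult_left_zero)
  finally show ?thesis unfolding integral_circle_powers by simp
qed

lemma monomial_L2_add: "monomial_L2 n (x + y) = monomial_L2 n x + monomial_L2 n y"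
  by transfer (auto simp: L2_rel_def scaleC_add_right
      intro!: square_integrable_add square_integrable_monomial)

lemma monomial_L2_scaleC: "monomial_L2 n (c *\<^sub>C x) = c *\<^sub>C monomial_L2 n x"
proof transfer
  fix n c and x :: 'a
  show "L2_rel (\<lambda>z. z ^ n *\<^sub>C c *\<^sub>C x) (\<lambda>z. c *\<^sub>C z ^ n *\<^sub>C x)"
    using square_integrable_monomial[of n "c *\<^sub>C x"]
    by (simp add: L2_rel_def scaleC_scaleC mult.commute)
qed

lemma monomial_L2_zero [simp]: "monomial_L2 n 0 = 0"
  using monomial_L2_add[of n 0 0] by simp

lemma norm_monomial_L2 [simp]: "norm (monomial_L2 n x) = norm x"
  unfolding norm_eq_sqrt_inner inner_eq_Re_cinner by (simp add: cinner_monomial_L2)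

lemma square_integrable_mult_z: "square_integrable f \<Longrightarrow> square_integrable (\<lambda>z. z *\<^sub>C f z)"
  by (rule square_integrable_scaleC_fun[OF _ _ AE_circle_norm]) auto

lemma mult_z_add: "mult_z (f + g) = mult_z f + mult_z g"
  by transfer (auto simp: L2_rel_def scaleC_add_right
      intro!: square_integrable_add square_integrable_mult_z)

lemma mult_z_scaleC: "mult_z (c *\<^sub>C f) = c *\<^sub>C mult_z f"
proof transfer
  fix c and f :: "complex \<Rightarrow> 'a"
  assume "L2_rel f f"
  then show "L2_rel (\<lambda>z. z *\<^sub>C c *\<^sub>C f z) (\<lambda>z. c *\<^sub>C z *\<^sub>C f z)"
    using square_integrable_scaleC[OF square_integrable_mult_z, of f c]
    by (simp add: L2_rel_def scaleC_scaleC mult.commute)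
qed

lemma mult_z_monomial_L2: "mult_z (monomial_L2 n x) = monomial_L2 (Suc n) x"
proof transfer
  fix n and x :: 'a
  show "L2_rel (\<lambda>z. z *\<^sub>C z ^ n *\<^sub>C x) (\<lambda>z. z ^ Suc n *\<^sub>C x)"
    using square_integrable_monomial[of "Suc n" x] by (simp add: L2_rel_def scaleC_scaleC)
qed

lemma mult_z_constant_L2: "mult_z (constant_L2 x) = monomial_L2 (Suc 0) x"
proof transfer
  fix x :: 'a
  show "L2_rel (\<lambda>z. z *\<^sub>C x) (\<lambda>z. z ^ Suc 0 *\<^sub>C x)"
    using square_integrable_monomial[of "Suc 0" x] by (simp add: L2_rel_def)
qed

text \<open>The factor \<open>z * cnj z\<close> equals 1 almost everywhere because the measure is
  concentrated on the unit circle.\<close>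

lemma cinner_mult_z: "cinner (mult_z f) (mult_z g) = cinner f g"
proof transfer
  fix f g :: "complex \<Rightarrow> 'a"
  assume "L2_rel f f" "L2_rel g g"
  then have si: "square_integrable f" "square_integrable g" by (auto simp: L2_rel_def)
  show "(\<integral>z. cinner (z *\<^sub>C f z) (z *\<^sub>C g z) \<partial>circle_measure) =
      (\<integral>z. cinner (f z) (g z) \<partial>circle_measure)"
  proof (rule integral_cong_AE)
    show "AE z in circle_measure. cinner (z *\<^sub>C f z) (z *\<^sub>C g z) = cinner (f z) (g z)"
      using AE_circle_norm
    proof eventually_elim
      case (elim z)
      then have "z * cnj z = 1" by (simp add: complex_norm_square[symmetric])
      then show ?case
        by (simp add: cinner_scaleC_left cinner_scaleC_right mult.assoc[symmetric] mult.commute)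
    qed
  qed (use si in \<open>auto intro!: borel_measurable_integrable square_integrable_cinner
      square_integrable_mult_z\<close>)
qed

section \<open>Isometric operators\<close>

lemma bounded_linear_if_isometry:
  fixes T :: "'a::complex_inner \<Rightarrow> 'b::complex_inner"
  assumes "\<And>x y. T (x + y) = T x + T y" "\<And>c x. T (c *\<^sub>C x) = c *\<^sub>C T x"
    and "\<And>x y. cinner (T x) (T y) = cinner x y"
  shows "bounded_linear T"
  by (rule bounded_linear_intro[where K = 1])
    (auto simp: assms scaleR_scaleC intro!: eq_refl norm_eq_if_cinner_eq)

lemma bounded_linear_mult_z: "bounded_linear mult_z"
  by (intro bounded_linear_if_isometry mult_z_add mult_z_scaleC cinner_mult_z)

text \<open>An isometric image of a complete space is complete. This is used for the powers of
  \<open>S 0\<close> and for \<open>U\<close>.\<close>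

lemma closed_range_isometry:
  fixes T :: "'a::{real_normed_vector, complete_space} \<Rightarrow> 'b::{real_normed_vector, complete_space}"
  assumes "bounded_linear T" "\<And>x. norm (T x) = norm x"
  shows "closed (range T)"
  by (intro complete_imp_closed complete_isometric_image[of 1])
    (auto simp: assms complete_UNIV)

lemma sum_axis: "(\<Sum>i\<in>UNIV. axis i (y $ i)) = (y :: 'a::comm_monoid_add ^ 'n)"
  by (simp add: vec_eq_iff axis_def if_distrib[of "\<lambda>f. f _"] cong: if_cong)

section \<open>The Wold decomposition of a Cuntz representation\<close>

text \<open>\<open>slot\<close> identifies the indices \<open>{1..N - 1}\<close> with the finite
  type \<open>'n\<close>, so that \<open>'k ^ 'n\<close> is the direct sum of \<open>N - 1\<close>
  copies of the Hilbert space.\<close>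

locale cuntz_shift =
  fixes N :: nat and S :: "nat \<Rightarrow> 'k::chilbert_space \<Rightarrow> 'k" and slot :: "nat \<Rightarrow> 'n::finite"
  assumes N: "N \<ge> 2"
    and slot: "bij_betw slot {1..N - 1} UNIV"
    and cuntz: "cuntz_representation N S"
    and shift: "is_shift (S 0)"
begin

definition R :: "'k \<Rightarrow> 'k" where
  "R = cadjoint (S 0)"

definition T :: "'k \<Rightarrow> 'k ^ 'n" where
  "T x = (\<chi> i. cadjoint (S (inv_into {1..N - 1} slot i)) x)"

text \<open>The exponent is \<open>Suc k\<close> because \<open>H_plus\<close> starts with the first
  power of \<open>z\<close>.\<close>

definition U :: "'k \<Rightarrow> ('k ^ 'n) L2_circle" where
  "U x = (\<Sum>k. monomial_L2 (Suc k) (T ((R ^^ k) x)))"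

section \<open>The Cuntz relations in terms of \<open>R\<close> and \<open>T\<close>\<close>

lemma bounded_clinear_S: "i < N \<Longrightarrow> bounded_clinear (S i)"
  using cuntz by (simp add: cuntz_representation_def)

lemma cadjoint_S_S: "i < N \<Longrightarrow> j < N \<Longrightarrow> cadjoint (S i) (S j x) = (if i = j then x else 0)"
  using cuntz by (simp add: cuntz_representation_def)

lemma inv_slot: "inv_into {1..N - 1} slot i \<in> {1..N - 1}" "inv_into {1..N - 1} slot i < N"
  "inv_into {1..N - 1} slot i \<noteq> 0"
proof -
  show "inv_into {1..N - 1} slot i \<in> {1..N - 1}"
    using slot by (intro inv_into_into) (simp add: bij_betw_def)
  then show "inv_into {1..N - 1} slot i < N" "inv_into {1..N - 1} slot i \<noteq> 0" using N by auto
qed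

lemma R_S0: "R (S 0 x) = x"
  using N by (simp add: R_def cadjoint_S_S)

lemma R_S: "j \<in> {1..N - 1} \<Longrightarrow> R (S j x) = 0"
  using N by (auto simp: R_def cadjoint_S_S)

lemma T_S0: "T (S 0 x) = 0"
  using N by (simp add: T_def vec_eq_iff cadjoint_S_S inv_slot(2,3)[unfolded One_nat_def])

lemma T_S:
  assumes "j \<in> {1..N - 1}"
  shows "T (S j x) = axis (slot j) x"
proof -
  have "j < N" using assms N by auto
  have "inv_into {1..N - 1} slot i = j \<longleftrightarrow> i = slot j" for i
    using slot assms by (metis bij_betw_inv_into_left bij_betw_inv_into_right UNIV_I)
  with cadjoint_S_S[OF inv_slot(2) \<open>j < N\<close>]
  have "cadjoint (S (inv_into {1..N - 1} slot i)) (S j x) = (if i = slot j then x else 0)" for i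
    by presburger
  then show ?thesis
    by (simp only: T_def vec_eq_iff axis_def vec_lambda_beta) simp
qed

lemma R_add: "R (x + y) = R x + R y" and R_scaleC: "R (c *\<^sub>C x) = c *\<^sub>C R x"
  using bounded_clinear_cadjoint[OF bounded_clinear_S, of 0] N by (simp_all add: R_def)

lemma T_add: "T (x + y) = T x + T y" and T_scaleC: "T (c *\<^sub>C x) = c *\<^sub>C T x"
  using bounded_clinear_cadjoint[OF bounded_clinear_S[OF inv_slot(2)]]
  by (simp_all add: T_def vec_eq_iff scaleC_vec_def)

lemma R_zero [simp]: "R 0 = 0" and T_zero [simp]: "T 0 = 0"
  using R_add[of 0 0] T_add[of 0 0] by simp_all

lemma funpow_R_add: "(R ^^ k) (x + y) = (R ^^ k) x + (R ^^ k) y"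
  and funpow_R_scaleC: "(R ^^ k) (c *\<^sub>C x) = c *\<^sub>C (R ^^ k) x"
  and funpow_R_zero: "(R ^^ k) 0 = 0"
  by (induction k) (simp_all add: R_add R_scaleC)

text \<open>The relation expressing the identity as a sum of range projections is inserted next to
  \<open>y\<close>, and each \<open>S i\<close> moves across as its adjoint; index 0 gives
  \<open>R\<close>, the others give \<open>T\<close>.\<close>

lemma cinner_R_T: "cinner x y = cinner (R x) (R y) + cinner (T x) (T y)"
proof -
  have "cinner x y = cinner x (\<Sum>i<N. S i (cadjoint (S i) y))"
    using cuntz by (simp add: cuntz_representation_def)
  also have "\<dots> = (\<Sum>i<N. cinner (cadjoint (S i) x) (cadjoint (S i) y))"
    by (simp add: cinner_sum_right cinner_cadjoint bounded_clinear_S)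
  also have "{..<N} = insert 0 {1..N - 1}" using N by auto
  also have "(\<Sum>i\<in>insert 0 {1..N - 1}. cinner (cadjoint (S i) x) (cadjoint (S i) y)) =
      cinner (R x) (R y) + (\<Sum>i\<in>{1..N - 1}. cinner (cadjoint (S i) x) (cadjoint (S i) y))"
    by (simp add: R_def)
  also have "(\<Sum>i\<in>{1..N - 1}. cinner (cadjoint (S i) x) (cadjoint (S i) y)) =
      cinner (T x) (T y)"
    unfolding cinner_vec_def T_def vec_lambda_beta
    by (rule sum.reindex_bij_betw[OF bij_betw_inv_into[OF slot], symmetric])
  finally show ?thesis .
qed

text \<open>Iterates \<open>cinner_R_T\<close> on the remainder. The form with two vectors serves to
  show that \<open>U\<close> preserves inner products.\<close>

lemma cinner_wold:
  "cinner x y =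
    (\<Sum>k<n. cinner (T ((R ^^ k) x)) (T ((R ^^ k) y))) + cinner ((R ^^ n) x) ((R ^^ n) y)"
proof (induction n)
  case (Suc n)
  then show ?case using cinner_R_T[of "(R ^^ n) x" "(R ^^ n) y"] by simp
qed simp

lemma norm_wold: "(norm x)\<^sup>2 = (\<Sum>k<n. (norm (T ((R ^^ k) x)))\<^sup>2) + (norm ((R ^^ n) x))\<^sup>2"
  using cinner_wold[of x x n] unfolding cinner_self
  by (simp only: of_real_sum[symmetric] of_real_add[symmetric] of_real_eq_iff)

section \<open>Convergence of the powers of \<open>R\<close> to zero\<close>

lemma bounded_linear_funpow_S0: "bounded_linear (S 0 ^^ n)"
proof (induction n)
  case (Suc n)
  then show ?case
    using shift by (auto simp: is_shift_def bounded_clinear_def intro: bounded_linear_compose)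
qed (simp add: id_def bounded_linear_ident)

lemma norm_funpow_S0: "norm ((S 0 ^^ n) x) = norm x"
  using shift by (induction n) (auto simp: is_shift_def)

lemma cinner_funpow_S0: "cinner ((R ^^ n) x) y = cinner x ((S 0 ^^ n) y)"
proof (induction n arbitrary: y)
  case (Suc n)
  have "cinner (R z) y = cinner z (S 0 y)" for z
    unfolding R_def using N by (simp add: cinner_cadjoint bounded_clinear_S)
  with Suc show ?case by (simp add: funpow_swap1[of "S 0"])
qed simp

text \<open>Pythagoras for the orthogonal projection \<open>S 0 ^^ n \<circ> R ^^ n\<close> onto the
  range of \<open>S 0 ^^ n\<close>.\<close>

lemma norm_diff_funpow_S0:
  "(norm (x - (S 0 ^^ n) ((R ^^ n) x)))\<^sup>2 = (norm x)\<^sup>2 - (norm ((R ^^ n) x))\<^sup>2"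
proof -
  let ?y = "(S 0 ^^ n) ((R ^^ n) x)"
  have "cinner x ?y = complex_of_real ((norm ((R ^^ n) x))\<^sup>2)"
    by (simp only: cinner_funpow_S0[symmetric] cinner_self)
  then have "inner x ?y = (norm ((R ^^ n) x))\<^sup>2" by (simp add: inner_eq_Re_cinner)
  moreover have "inner ?y ?y = (norm ((R ^^ n) x))\<^sup>2"
    by (simp add: power2_norm_eq_inner[symmetric] norm_funpow_S0)
  ultimately show ?thesis
    by (simp add: power2_norm_eq_inner inner_diff inner_commute)
qed

text \<open>\<open>Y n\<close> is the projection of \<open>x\<close> onto the range of
  \<open>S 0 ^^ n\<close> and has the norm of \<open>(R ^^ n) x\<close>. The limit of
  \<open>Y\<close> lies in all these ranges, whose intersection is trivial by the shift
  property.\<close>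

lemma funpow_R_tendsto_zero: "(\<lambda>n. (R ^^ n) x) \<longlonglongrightarrow> 0"
proof -
  define a where "a n = (norm ((R ^^ n) x))\<^sup>2" for n
  define Y where "Y n = (S 0 ^^ n) ((R ^^ n) x)" for n
  have "decseq a"
    by (rule decseq_SucI) (use norm_wold[of "(R ^^ n) x" 1 for n] in \<open>simp add: a_def\<close>)
  moreover have "0 \<le> a n" for n by (simp add: a_def)
  ultimately have "Cauchy a"
    by (metis LIMSEQ_imp_Cauchy decseq_convergent)
  \<comment> \<open>The isometry \<open>S 0 ^^ n\<close> factors out of \<open>Y n - Y m\<close>;
    what remains is the projection identity for \<open>w\<close> with exponent
    \<open>m - n\<close>.\<close>
  have Y_diff: "(dist (Y n) (Y m))\<^sup>2 = a n - a m" if "n \<le> m" for n m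
  proof -
    define w where "w = (R ^^ n) x"
    have R_m: "(R ^^ m) x = (R ^^ (m - n)) w"
      using that funpow_add[of "m - n" n R] by (simp add: w_def)
    moreover have "S 0 ^^ m = S 0 ^^ n \<circ> S 0 ^^ (m - n)"
      using that funpow_add[of n "m - n" "S 0"] by simp
    ultimately have "Y m = (S 0 ^^ n) ((S 0 ^^ (m - n)) ((R ^^ (m - n)) w))"
      by (simp add: Y_def)
    then have "dist (Y n) (Y m) = norm (w - (S 0 ^^ (m - n)) ((R ^^ (m - n)) w))"
      by (simp add: dist_norm Y_def norm_funpow_S0 flip: w_def
          linear_diff[OF bounded_linear.linear[OF bounded_linear_funpow_S0]])
    then show ?thesis
      using norm_diff_funpow_S0[of w "m - n"] by (simp add: a_def R_m) (simp add: w_def)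
  qed
  have "Cauchy Y"
  proof (rule metric_CauchyI)
    fix e :: real assume e: "e > 0"
    then obtain M where M: "\<And>m n. m \<ge> M \<Longrightarrow> n \<ge> M \<Longrightarrow> dist (a m) (a n) < e\<^sup>2"
      using metric_CauchyD[OF \<open>Cauchy a\<close>, of "e\<^sup>2"] by auto
    have "dist (Y n) (Y m) < e" if "n \<le> m" "n \<ge> M" for n m
    proof (rule power_less_imp_less_base)
      show "(dist (Y n) (Y m))\<^sup>2 < e\<^sup>2"
        using M[of n m] that by (simp add: Y_diff dist_real_def)
    qed (use e in simp)
    then have "dist (Y n) (Y m) < e" if "n \<ge> M" "m \<ge> M" for n m
      using that by (metis dist_commute nle_le)
    then show "\<exists>M. \<forall>m\<ge>M. \<forall>n\<ge>M. dist (Y m) (Y n) < e" by blast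
  qed
  then obtain y where y: "Y \<longlonglongrightarrow> y" using Cauchy_convergent convergent_def by blast
  have "y \<in> range (S 0 ^^ n)" for n
  proof (rule closed_sequentially)
    show "closed (range (S 0 ^^ n))"
      by (intro closed_range_isometry bounded_linear_funpow_S0 norm_funpow_S0)
    \<comment> \<open>Only the tail of \<open>Y\<close> from index \<open>n\<close> on is known to
      lie in this range, hence the shifted index.\<close>
    show "Y (k + n) \<in> range (S 0 ^^ n)" for k
      by (simp add: Y_def add.commute[of k] funpow_add)
    show "(\<lambda>k. Y (k + n)) \<longlonglongrightarrow> y" using y by (rule LIMSEQ_ignore_initial_segment)
  qed
  then have "y = 0" using shift by (auto simp: is_shift_def)
  with y have "(\<lambda>n. norm (Y n)) \<longlonglongrightarrow> 0" by (simp add: tendsto_norm_zero)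
  then show ?thesis by (simp add: Y_def norm_funpow_S0 tendsto_norm_zero_iff)
qed

section \<open>The isometry \<open>U\<close>\<close>

lemma summable_U: "summable (\<lambda>k. monomial_L2 (Suc k) (T ((R ^^ k) x)))"
proof (rule summable_orthogonal)
  \<comment> \<open>Dropping the remainder in \<open>norm_wold\<close> gives a Bessel
    inequality.\<close>
  have "(\<Sum>k<n. (norm (T ((R ^^ k) x)))\<^sup>2) \<le> (norm x)\<^sup>2" for n
    using norm_wold[of x n] by simp
  then show "summable (\<lambda>k. (norm (monomial_L2 (Suc k) (T ((R ^^ k) x))))\<^sup>2)"
    by (intro summableI_nonneg_bounded) auto
qed (simp add: inner_eq_Re_cinner cinner_monomial_L2)

lemma U_LIMSEQ: "(\<lambda>n. \<Sum>k<n. monomial_L2 (Suc k) (T ((R ^^ k) x))) \<longlonglongrightarrow> U x"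
  unfolding U_def by (rule summable_LIMSEQ[OF summable_U])

lemma U_add: "U (x + y) = U x + U y"
  unfolding U_def by (simp add: funpow_R_add T_add monomial_L2_add suminf_add summable_U)

lemma U_scaleC: "U (c *\<^sub>C x) = c *\<^sub>C U x"
  unfolding U_def
  by (simp add: funpow_R_scaleC T_scaleC monomial_L2_scaleC summable_U
      bounded_linear.suminf[OF bounded_bilinear.bounded_linear_right[OF bounded_bilinear_scaleC]])

text \<open>By \<open>cinner_wold\<close> the partial sums miss the inner product of
  \<open>x\<close> and \<open>y\<close> exactly by that of the remainders, which tends to
  zero.\<close>

lemma cinner_U: "cinner (U x) (U y) = cinner x y"
proof (rule LIMSEQ_unique)
  let ?p = "\<lambda>x n. \<Sum>k<n. monomial_L2 (Suc k) (T ((R ^^ k) x))"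
  show "(\<lambda>n. cinner (?p x n) (?p y n)) \<longlonglongrightarrow> cinner (U x) (U y)"
    by (intro bounded_bilinear.tendsto[OF bounded_bilinear_cinner] U_LIMSEQ)
  have "cinner (?p x n) (?p y n) = cinner x y - cinner ((R ^^ n) x) ((R ^^ n) y)" for n
    unfolding cinner_sum_left cinner_sum_right cinner_monomial_L2
    using cinner_wold[of x y n] by (simp add: sum.delta cong: if_cong)
  moreover have "(\<lambda>n. cinner x y - cinner ((R ^^ n) x) ((R ^^ n) y)) \<longlonglongrightarrow> cinner x y - cinner (0 :: 'k) 0"
    by (intro tendsto_diff tendsto_const bounded_bilinear.tendsto[OF bounded_bilinear_cinner]
        funpow_R_tendsto_zero)
  ultimately show "(\<lambda>n. cinner (?p x n) (?p y n)) \<longlonglongrightarrow> cinner x y" by simp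
qed

lemma bounded_linear_U: "bounded_linear U"
  by (intro bounded_linear_if_isometry U_add U_scaleC cinner_U)

text \<open>Since \<open>T\<close> kills the range of \<open>S 0\<close> and \<open>R\<close> undoes
  \<open>S 0\<close>, the first term drops out and all others move up by one power of
  \<open>z\<close>.\<close>

lemma U_S0: "U (S 0 x) = mult_z (U x)"
proof -
  have "mult_z (U x) = (\<Sum>k. monomial_L2 (Suc (Suc k)) (T ((R ^^ k) x)))"
    unfolding U_def
    by (simp add: bounded_linear.suminf[OF bounded_linear_mult_z summable_U] mult_z_monomial_L2)
  also have "\<dots> = U (S 0 x)"
    unfolding U_def using suminf_split_head[OF summable_U, of "S 0 x"]
    by (simp add: T_S0 R_S0 funpow_swap1[of R])
  finally show ?thesis by simp
qed

text \<open>\<open>R\<close> annihilates the range of \<open>S j\<close>, so only the term with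
  \<open>k = 0\<close> survives.\<close>

lemma U_S:
  assumes "j \<in> {1..N - 1}"
  shows "U (S j x) = mult_z (constant_L2 (axis (slot j) x))"
proof -
  have "T ((R ^^ k) (S j x)) = 0" if "k \<noteq> 0" for k
    using that assms by (cases k) (simp_all add: R_S funpow_R_zero funpow_swap1)
  then have "U (S j x) = (\<Sum>k\<in>{0}. monomial_L2 (Suc k) (T ((R ^^ k) (S j x))))"
    unfolding U_def by (intro suminf_finite) auto
  then show ?thesis using assms by (simp add: T_S mult_z_constant_L2)
qed

section \<open>The range of \<open>U\<close>\<close>

lemma subspace_range_U: "complex_vector.subspace (range U)"
proof (rule complex_vector.subspaceI)
  show "0 \<in> range U" using U_add[of 0 0] by (metis add_cancel_right_left rangeI)
qed (auto simp flip: U_add U_scaleC)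

text \<open>For the first power, \<open>y\<close> splits into its slots, each reached through
  \<open>U_S\<close>; \<open>U_S0\<close> raises the power.\<close>

lemma monomial_in_range_U: "monomial_L2 (Suc n) y \<in> range U"
proof (induction n)
  case 0
  have "monomial_L2 (Suc 0) (axis i (y $ i)) \<in> range U" for i
  proof -
    obtain j where "j \<in> {1..N - 1}" "slot j = i"
      using slot by (metis UNIV_I bij_betw_def imageE)
    with U_S[of j "y $ i"] show ?thesis by (metis mult_z_constant_L2 rangeI)
  qed
  then have "(\<Sum>i\<in>UNIV. monomial_L2 (Suc 0) (axis i (y $ i))) \<in> range U"
    by (intro complex_vector.subspace_sum[OF subspace_range_U])
  also have "(\<Sum>i\<in>UNIV. monomial_L2 (Suc 0) (axis i (y $ i))) =
      monomial_L2 (Suc 0) (\<Sum>i\<in>UNIV. axis i (y $ i))"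
    using sum_comp_morphism[of "monomial_L2 (Suc 0)" "\<lambda>i. axis i (y $ i)" UNIV]
    by (simp add: monomial_L2_add comp_def)
  finally show ?case by (simp add: sum_axis)
next
  case (Suc n)
  then obtain x where "monomial_L2 (Suc n) y = U x" by blast
  then have "monomial_L2 (Suc (Suc n)) y = U (S 0 x)"
    by (simp add: U_S0 flip: mult_z_monomial_L2)
  then show ?case by simp
qed

text \<open>The partial sums of \<open>U x\<close> lie in the span of the monomials. Conversely, the
  range is a closed subspace containing these generators.\<close>

lemma range_U: "range U = H_plus"
proof
  have "monomial_L2 (Suc k) y \<in> {monomial_L2 n x | n x. n \<ge> 1}" for k and y :: "'k ^ 'n"
    by auto
  then have "(\<Sum>k<n. monomial_L2 (Suc k) (T ((R ^^ k) x))) \<in> H_plus" for n x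
    unfolding H_plus_def
    by (intro subsetD[OF closure_subset] complex_vector.span_sum complex_vector.span_base)
  then show "range U \<subseteq> H_plus"
    using closed_sequentially[OF closed_closure _ U_LIMSEQ] unfolding H_plus_def by blast
next
  have "{monomial_L2 n x | n x. n \<ge> 1} \<subseteq> range U"
  proof safe
    fix n :: nat and x :: "'k ^ 'n" assume "n \<ge> 1"
    then show "monomial_L2 n x \<in> range U" using monomial_in_range_U[of "n - 1" x] by simp
  qed
  moreover have "closed (range U)"
    by (intro closed_range_isometry bounded_linear_U norm_eq_if_cinner_eq cinner_U)
  ultimately show "H_plus \<subseteq> range U"
    unfolding H_plus_def
    by (intro closure_minimal complex_vector.span_minimal subspace_range_U)
qed

end

theorem theorem6p2:
  fixes N :: nat
    and S :: "nat \<Rightarrow> 'k::chilbert_space \<Rightarrow> 'k"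
    and slot :: "nat \<Rightarrow> 'n::finite"
  assumes "N \<ge> 2"
    and "bij_betw slot {1..N - 1} UNIV"
    and "cuntz_representation N S"
    and "is_shift (S 0)"
  shows "\<exists>V :: ('k ^ 'n) L2_circle \<Rightarrow> 'k.
    unitary_on H_plus V \<and>
    (let S_plus = (\<lambda>j. cadjoint_on H_plus V \<circ> S j \<circ> V)
     in (\<forall>\<psi>\<in>H_plus. S_plus 0 \<psi> = mult_z \<psi>) \<and>
        (\<forall>j\<in>{1..N - 1}. \<forall>\<psi>\<in>H_plus.
           S_plus j \<psi> = mult_z (constant_L2 (axis (slot j) (V \<psi>)))))"
proof -
  interpret cuntz_shift N S slot using assms by unfold_locales
  \<comment> \<open>As \<open>U\<close> is injective with range \<open>H_plus\<close>, this is a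
    two-sided inverse there; off \<open>H_plus\<close> its values are arbitrary choices.\<close>
  define V where "V = inv U"
  have "inj U"
  proof (rule injI)
    fix x y assume "U x = U y"
    then have "U (x - y) = 0"
      by (simp add: linear_diff[OF bounded_linear.linear[OF bounded_linear_U]])
    then have "cinner (x - y) (x - y) = 0"
      by (simp flip: cinner_U)
    then show "x = y" by (simp add: cinner_self)
  qed
  then have V_U: "V (U x) = x" for x by (simp add: V_def)
  \<comment> \<open>The adjoint of the unitary \<open>V\<close> is its inverse: every element of
    \<open>H_plus\<close> has the form \<open>U g\<close>, and \<open>U\<close> preserves inner
    products.\<close>
  have adjoint: "cadjoint_on H_plus V x = U x" for x
    unfolding range_U[symmetric]
    by (rule cadjoint_on_eqI)
      (auto simp: V_U cinner_U simp flip: linear_diff[OF bounded_linear.linear[OF bounded_linear_U]])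
  have "unitary_on H_plus V"
    unfolding unitary_on_def range_U[symmetric]
    by (auto simp: V_U cinner_U image_image simp flip: U_add U_scaleC)
  moreover have "(cadjoint_on H_plus V \<circ> S 0 \<circ> V) \<psi> = mult_z \<psi>" if "\<psi> \<in> H_plus" for \<psi>
    using that unfolding range_U[symmetric] by (auto simp: adjoint[unfolded range_U[symmetric]] V_U U_S0)
  moreover have "(cadjoint_on H_plus V \<circ> S j \<circ> V) \<psi> = mult_z (constant_L2 (axis (slot j) (V \<psi>)))"
    if "j \<in> {1..N - 1}" for j \<psi>
    using U_S[OF that] by (simp add: adjoint)
  ultimately show ?thesis unfolding Let_def by blast
qed

end
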